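(* Let $\mathbf{T}=(T_1,\dots,T_7)$ be a $\Gamma_{E(3;3;1,1,1)}$-contraction on a Hilbert space. The fundamental operators of $\mathbf{T}$ are the unique bounded linear operators $X_i$ and $X_{7-i}$, $1\le i\le6$, on $\mathcal{D}_{T_7}$ satisfying the operator equations $$D_{T_7}T_i=X_iD_{T_7}+X_{7-i}^*D_{T_7}T_7\quad\text{and}\quad D_{T_7}T_{7-i}=X_{7-i}D_{T_7}+X_i^*D_{T_7}T_7,\qquad 1\le i\le6.$$
   Context: For a contraction $T$, $D_T=(I-T^*T)^{1/2}$ and $\mathcal{D}_T$ is the closure of its range. For $A\in M_3(\mathbb{C})$ let $\mu(A)=1/\inf\{\|X\|: X\in M_3(\mathbb{C})\text{ diagonal},\ \det(I-AX)=0\}$ (operator norm), with $\mu(A)=0$ if $I-AX$ is nonsingular for all diagonal $X$. $\Gamma_{E(3;3;1,1,1)}$ is the set of all $(x_1,\dots,x_7)\in\mathbb{C}^7$ with $x_1=a_{11}$, $x_2=a_{22}$, $x_3=a_{11}a_{22}-a_{12}a_{21}$, $x_4=a_{33}$, $x_5=a_{11}a_{33}-a_{13}a_{31}$, $x_6=a_{22}a_{33}-a_{23}a_{32}$, $x_7=\det A$ for some $A=(a_{ij})\in M_3(\mathbb{C})$ with $\mu(A)\le 1$. A commuting $7$-tuple $\mathbf{T}$ of bounded operators is a $\Gamma_{E(3;3;1,1,1)}$-contraction if this set is a spectral set for $\mathbf{T}$: its Taylor joint spectrum lies in the set and $\|f(\mathbf{T})\|\le\sup_{\Gamma_{E(3;3;1,1,1)}}|f|$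 for every $f$ holomorphic on a neighbourhood of the set. The fundamental operators of such $\mathbf{T}$ are the unique solutions $F_1,\dots,F_6\in\mathcal{B}(\mathcal{D}_{T_7})$ of the equations $T_i-T_{7-i}^*T_7=D_{T_7}F_iD_{T_7}$, $1\le i\le6$. *)

theory Defs
  imports "HOL-Analysis.Analysis"
begin

section \<open>Complex Hilbert spaces and their operators\<close>

text \<open>The inner product is linear in the first argument. The zero space is allowed.\<close>

class chilbert_space = banach +
  fixes scaleC :: "complex \<Rightarrow> 'a \<Rightarrow> 'a" (infixr "*\<^sub>C" 75)
    and cinner :: "'a \<Rightarrow> 'a \<Rightarrow> complex"
  assumes scaleC_add_right: "c *\<^sub>C (x + y) = c *\<^sub>C x + c *\<^sub>C y"
    and scaleC_add_left: "(c + d) *\<^sub>C x = c *\<^sub>C x + d *\<^sub>C x"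
    and scaleC_scaleC: "c *\<^sub>C d *\<^sub>C x = (c * d) *\<^sub>C x"
    and scaleC_of_real: "complex_of_real r *\<^sub>C x = r *\<^sub>R x"
    and cinner_commute: "cinner x y = cnj (cinner y x)"
    and cinner_add_left: "cinner (x + y) z = cinner x z + cinner y z"
    and cinner_scaleC_left: "cinner (c *\<^sub>C x) y = c * cinner x y"
    and cinner_self: "cinner x x = complex_of_real ((norm x)\<^sup>2)"

instantiation complex :: chilbert_space
begin
definition "c *\<^sub>C (x :: complex) = c * x"
definition "cinner (x :: complex) y = x * cnj y"
instance
  by standard
    (simp_all add: scaleC_complex_def cinner_complex_def algebra_simps scaleR_conv_of_real
      flip: complex_norm_square)
end

text \<open>
  The bounded complex-linear operators on a closed subspace \<open>M\<close>. They are set to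
  \<^const>\<open>undefined\<close> outside \<open>M\<close>, so that equality of operators on \<open>M\<close> is equality of
  functions; for \<open>M = UNIV\<close> this is no restriction.
\<close>

definition bounded_ops :: "'a::chilbert_space set \<Rightarrow> ('a \<Rightarrow> 'a) set" where
  "bounded_ops M = {X \<in> M \<rightarrow>\<^sub>E M.
     (\<forall>x\<in>M. \<forall>y\<in>M. X (x + y) = X x + X y) \<and>
     (\<forall>c. \<forall>x\<in>M. X (c *\<^sub>C x) = c *\<^sub>C X x) \<and>
     (\<exists>K. \<forall>x\<in>M. norm (X x) \<le> K * norm x)}"

definition adj_on :: "'a::chilbert_space set \<Rightarrow> ('a \<Rightarrow> 'a) \<Rightarrow> 'a \<Rightarrow> 'a" where
  "adj_on M X = (THE Y. Y \<in> bounded_ops M \<and>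
     (\<forall>x\<in>M. \<forall>y\<in>M. cinner (X x) y = cinner x (Y y)))"

abbreviation adj :: "('a::chilbert_space \<Rightarrow> 'a) \<Rightarrow> 'a \<Rightarrow> 'a" where
  "adj \<equiv> adj_on UNIV"

definition positive_op :: "('a::chilbert_space \<Rightarrow> 'a) \<Rightarrow> bool" where
  "positive_op S \<longleftrightarrow> S \<in> bounded_ops UNIV \<and> (\<forall>x. cinner (S x) x \<in> \<real>\<^sub>\<ge>\<^sub>0)"

definition sqrt_op :: "('a::chilbert_space \<Rightarrow> 'a) \<Rightarrow> 'a \<Rightarrow> 'a" where
  "sqrt_op P = (THE S. positive_op S \<and> S \<circ> S = P)"

definition defect_op :: "('a::chilbert_space \<Rightarrow> 'a) \<Rightarrow> 'a \<Rightarrow> 'a" where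
  "defect_op T = sqrt_op (\<lambda>x. x - adj T (T x))"

definition defect_space :: "('a::chilbert_space \<Rightarrow> 'a) \<Rightarrow> 'a set" where
  "defect_space T = closure (range (defect_op T))"

definition commuting_tuple :: "('i \<Rightarrow> 'a::chilbert_space \<Rightarrow> 'a) \<Rightarrow> bool" where
  "commuting_tuple T \<longleftrightarrow>
     (\<forall>i. T i \<in> bounded_ops UNIV) \<and> (\<forall>i j. T i \<circ> T j = T j \<circ> T i)"

section \<open>Taylor joint spectrum\<close>

text \<open>
  An element \<open>\<Sum>\<^sub>J \<omega>(J) \<otimes> e\<^sub>J\<close> of the tensor product of \<open>H\<close> with the exterior algebra on
  generators \<open>e\<^sub>i\<close>, \<open>i \<in> I\<close>, is represented by its coefficients \<open>\<omega>(J)\<close>, \<open>J \<subseteq> I\<close>; values of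
  \<open>\<omega>\<close> at other sets are irrelevant. The map \<open>koszul A\<close> is the Koszul differential
  \<open>x \<otimes> e \<mapsto> \<Sum>\<^sub>i A\<^sub>i x \<otimes> (e\<^sub>i \<and> e)\<close>.
\<close>

definition koszul ::
    "('i::linorder \<Rightarrow> 'a::chilbert_space \<Rightarrow> 'a) \<Rightarrow> ('i set \<Rightarrow> 'a) \<Rightarrow> 'i set \<Rightarrow> 'a" where
  "koszul A \<omega> J = (\<Sum>i\<in>J. (- 1) ^ card {j \<in> J. j < i} *\<^sub>R A i (\<omega> (J - {i})))"

text \<open>The kernel of the differential is its range. The differential is homogeneous, so this is
  exactness of the Koszul complex in every degree.\<close>

definition taylor_nonsingular ::
    "'i::linorder set \<Rightarrow> ('i \<Rightarrow> 'a::chilbert_space \<Rightarrow> 'a) \<Rightarrow> bool" where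
  "taylor_nonsingular I A \<longleftrightarrow>
     (\<forall>\<omega>. (\<forall>J\<subseteq>I. koszul A \<omega> J = 0) \<longrightarrow> (\<exists>\<eta>. \<forall>J\<subseteq>I. \<omega> J = koszul A \<eta> J))"

definition taylor_spectrum ::
    "('n::{finite,linorder} \<Rightarrow> 'a::chilbert_space \<Rightarrow> 'a) \<Rightarrow> (complex ^ 'n::{finite,linorder}) set" where
  "taylor_spectrum T = {z. \<not> taylor_nonsingular UNIV (\<lambda>i x. T i x - (z $ i) *\<^sub>C x)}"

section \<open>Holomorphic functional calculus and spectral sets\<close>

definition mholomorphic_on :: "(complex ^ 'n \<Rightarrow> complex) \<Rightarrow> (complex ^ 'n) set \<Rightarrow> bool"
    (infix "mholomorphic'_on" 50) where
  "f mholomorphic_on U \<longleftrightarrow> open U \<and>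
     (\<forall>z\<in>U. \<exists>f'. (f has_derivative f') (at z) \<and> (\<forall>c v. f' (c *s v) = c * f' v))"

text \<open>
  Taylor's functional calculus \<open>f \<mapsto> f(T)\<close>, described by the properties that determine it
  uniquely (Taylor, Zame, Putinar): it is a continuous unital algebra homomorphism on the germs
  of holomorphic functions at the joint spectrum of \<open>T\<close> that maps the coordinate functions to
  the \<open>T\<^sub>i\<close> and has the spectral mapping property for tuples \<open>(g\<^sub>0, \<dots>, g\<^sub>m\<^sub>-\<^sub>1)\<close>.
\<close>

definition taylor_calculus ::
    "('n::{finite,linorder} \<Rightarrow> 'a::chilbert_space \<Rightarrow> 'a)
       \<Rightarrow> ((complex ^ 'n::{finite,linorder} \<Rightarrow> complex) \<Rightarrow> 'a \<Rightarrow> 'a) \<Rightarrow> bool" where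
  "taylor_calculus T \<Phi> \<longleftrightarrow>
     (\<forall>c. \<Phi> (\<lambda>z. c) = (\<lambda>x. c *\<^sub>C x)) \<and>
     (\<forall>i. \<Phi> (\<lambda>z. z $ i) = T i) \<and>
     (\<forall>U. open U \<and> taylor_spectrum T \<subseteq> U \<longrightarrow>
        (\<forall>f. f mholomorphic_on U \<longrightarrow> \<Phi> f \<in> bounded_ops UNIV) \<and>
        (\<forall>f g. f mholomorphic_on U \<and> g mholomorphic_on U \<longrightarrow>
           \<Phi> (\<lambda>z. f z + g z) = (\<lambda>x. \<Phi> f x + \<Phi> g x) \<and>
           \<Phi> (\<lambda>z. f z * g z) = \<Phi> f \<circ> \<Phi> g \<and>
           ((\<forall>z\<in>U. f z = g z) \<longrightarrow> \<Phi> f = \<Phi> g)) \<and>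
        (\<forall>F f. (\<forall>k. F k mholomorphic_on U) \<and> f mholomorphic_on U \<and>
           (\<forall>K. compact K \<and> K \<subseteq> U \<longrightarrow> uniform_limit K F f sequentially) \<longrightarrow>
           (\<lambda>k::nat. onorm (\<lambda>x. \<Phi> (F k) x - \<Phi> f x)) \<longlonglongrightarrow> 0) \<and>
        (\<forall>m g w. (\<forall>j<m. g j mholomorphic_on U) \<longrightarrow>
           (\<not> taylor_nonsingular {..<m::nat} (\<lambda>j x. \<Phi> (g j) x - w j *\<^sub>C x) \<longleftrightarrow>
            (\<exists>z\<in>taylor_spectrum T. \<forall>j<m. g j z = w j))))"

text \<open>The existential quantifier names the functional calculus, so \<open>\<Phi> f\<close> is \<open>f(T)\<close>.\<close>

definition spectral_set ::
    "(complex ^ 'n::{finite,linorder}) set \<Rightarrow> ('n::{finite,linorder} \<Rightarrow> 'a::chilbert_space \<Rightarrow> 'a) \<Rightarrow> bool" where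
  "spectral_set K T \<longleftrightarrow> taylor_spectrum T \<subseteq> K \<and>
     (\<exists>\<Phi>. taylor_calculus T \<Phi> \<and>
       (\<forall>U f. K \<subseteq> U \<and> f mholomorphic_on U \<longrightarrow> onorm (\<Phi> f) \<le> (SUP z\<in>K. cmod (f z))))"

section \<open>The domain and its contractions\<close>

definition mu_witnesses :: "complex ^ 3 ^ 3 \<Rightarrow> (complex ^ 3 ^ 3) set" where
  "mu_witnesses A = {X. (\<forall>i j. i \<noteq> j \<longrightarrow> X $ i $ j = 0) \<and> det (mat 1 - A ** X) = 0}"

definition mu :: "complex ^ 3 ^ 3 \<Rightarrow> real" where
  "mu A = (if mu_witnesses A = {} then 0
           else 1 / (INF X\<in>mu_witnesses A. onorm (\<lambda>v. X *v v)))"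

definition Gamma_E :: "(complex ^ 7) set" where
  "Gamma_E = {x. \<exists>A :: complex ^ 3 ^ 3. mu A \<le> 1 \<and>
     x $ 1 = A $ 1 $ 1 \<and>
     x $ 2 = A $ 2 $ 2 \<and>
     x $ 3 = A $ 1 $ 1 * A $ 2 $ 2 - A $ 1 $ 2 * A $ 2 $ 1 \<and>
     x $ 4 = A $ 3 $ 3 \<and>
     x $ 5 = A $ 1 $ 1 * A $ 3 $ 3 - A $ 1 $ 3 * A $ 3 $ 1 \<and>
     x $ 6 = A $ 2 $ 2 * A $ 3 $ 3 - A $ 2 $ 3 * A $ 3 $ 2 \<and>
     x $ 7 = det A}"

definition Gamma_E_contraction :: "(7 \<Rightarrow> 'a::chilbert_space \<Rightarrow> 'a) \<Rightarrow> bool" where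
  "Gamma_E_contraction T \<longleftrightarrow> commuting_tuple T \<and> spectral_set Gamma_E T"

text \<open>
  Tuples are indexed by the seven-element type \<open>7\<close>, whose arithmetic is modulo 7. The index
  \<open>7\<close> is its zero, and \<open>7 - i\<close> has the expected value for \<open>i = 1, \<dots>, 6\<close>:
\<close>

lemma index_seven:
  "{1..6} = {1, 2, 3, 4, 5, 6 :: 7}" "- {7 :: 7} = {1..6}"
  "7 - 1 = (6 :: 7)" "7 - 2 = (5 :: 7)" "7 - 3 = (4 :: 7)"
  "7 - 4 = (3 :: 7)" "7 - 5 = (2 :: 7)" "7 - 6 = (1 :: 7)"
proof -
  have cases7: "x \<in> {0, 1, 2, 3, 4, 5, 6}" for x :: 7
  proof (cases x rule: bit1_cases)
    case (of_int z)
    then have "z \<in> {0, 1, 2, 3, 4, 5, 6}" by auto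
    then show ?thesis using of_int by auto
  qed
  show *: "{1..6} = {1, 2, 3, 4, 5, 6 :: 7}"
  proof (rule set_eqI)
    fix x :: 7
    show "x \<in> {1..6} \<longleftrightarrow> x \<in> {1, 2, 3, 4, 5, 6}"
      using cases7[of x]
      by (auto simp: less_eq_bit1_def bit1.Rep_1 bit1.Rep_0 bit1.Rep_numeral)
  qed
  show "- {7 :: 7} = {1..6}"
  proof (rule set_eqI)
    fix x :: 7
    show "x \<in> - {7} \<longleftrightarrow> x \<in> {1..6}"
      using cases7[of x] by (auto simp: *)
  qed
qed simp_all

definition op_tuples :: "'a::chilbert_space set \<Rightarrow> (7 \<Rightarrow> 'a \<Rightarrow> 'a) set" where
  "op_tuples M = ({1..6} \<rightarrow>\<^sub>E bounded_ops M)"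

definition fundamental_equations ::
    "(7 \<Rightarrow> 'a::chilbert_space \<Rightarrow> 'a) \<Rightarrow> (7 \<Rightarrow> 'a \<Rightarrow> 'a) \<Rightarrow> bool" where
  "fundamental_equations T F \<longleftrightarrow>
     (\<forall>i\<in>{1..6}. \<forall>h. T i h - adj (T (7 - i)) (T 7 h) =
        defect_op (T 7) (F i (defect_op (T 7) h)))"

definition fundamental_operators ::
    "(7 \<Rightarrow> 'a::chilbert_space \<Rightarrow> 'a) \<Rightarrow> (7 \<Rightarrow> 'a \<Rightarrow> 'a) \<Rightarrow> bool" where
  "fundamental_operators T F \<longleftrightarrow>
     F \<in> op_tuples (defect_space (T 7)) \<and> fundamental_equations T F \<and>
     (\<forall>G \<in> op_tuples (defect_space (T 7)). fundamental_equations T G \<longrightarrow> G = F)"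

end

theory Submission
  imports Defs
begin

text \<open>
  Write \<open>P = T\<^sub>7\<close>, \<open>D\<close> for its defect operator and \<open>A\<^sub>i = T\<^sub>i - T\<^sub>7\<^sub>-\<^sub>i\<^sup>* P\<close>. The proof has an existence part
  and a uniqueness part, joined by one inequality for linear pencils.

  \<^emph>\<open>The pencil inequality.\<close> If \<open>mu A \<le> 1\<close>, then the determinant of \<open>I - A X\<close> does not vanish for diagonal
  \<open>X\<close> with entries in the open unit disc. Setting two of the three entries equal and comparing the
  leading coefficient of the resulting quadratic polynomial with its constant term shows that every
  triple \<open>(x\<^sub>i, x\<^sub>7\<^sub>-\<^sub>i, x\<^sub>7)\<close> lies in the closed tetrablock, equivalently
  \<open>|x\<^sub>i - z x\<^sub>7| \<le> |1 - z x\<^sub>7\<^sub>-\<^sub>i|\<close> for \<open>|z| < 1\<close> (\<open>Gamma_E_pencil\<close>). The functional calculus turns this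
  into \<open>\<parallel>(T\<^sub>i - z P) h\<parallel> \<le> \<parallel>(I - z T\<^sub>7\<^sub>-\<^sub>i) h\<parallel>\<close> for \<open>|z| = 1\<close> (\<open>Gamma_E_contraction_pencil\<close>).

  \<^emph>\<open>Existence.\<close> Adding these inequalities for \<open>i\<close> and \<open>7 - i\<close> yields \<open>|\<langle>A\<^sub>i h, h\<rangle>| \<le> \<parallel>h\<parallel>\<^sup>2 - \<parallel>P h\<parallel>\<^sup>2 = \<parallel>D h\<parallel>\<^sup>2\<close>
  (\<open>pencil_estimate\<close>). By polarisation \<open>|\<langle>A\<^sub>i x, y\<rangle>| \<le> 2 \<parallel>D x\<parallel> \<parallel>D y\<parallel>\<close>, and such a form factors as
  \<open>A\<^sub>i = D F\<^sub>i D\<close> with \<open>F\<^sub>i\<close> on the closure of the range of \<open>D\<close> (\<open>sandwich_factorization\<close>); density of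
  the range makes \<open>F\<^sub>i\<close> unique.

  \<^emph>\<open>Characterisation.\<close> That \<open>F\<close> solves \<open>D T\<^sub>i = F\<^sub>i D + F\<^sub>7\<^sub>-\<^sub>i\<^sup>* D P\<close> is a computation with \<open>D\<^sup>2 = I - P\<^sup>* P\<close>.
  For another solution \<open>X\<close>, the difference \<open>Z = X - F\<close> satisfies \<open>D Z\<^sub>i D = P\<^sup>* (D Z\<^sub>i D) P\<close>. Iterating,
  \<open>\<langle>Z\<^sub>i D h, D k\<rangle> = \<langle>Z\<^sub>i D P\<^sup>n h, D P\<^sup>n k\<rangle>\<close>, and this tends to zero because \<open>\<parallel>D P\<^sup>n h\<parallel>\<^sup>2\<close> telescopes
  (\<open>invariant_form_zero\<close>).

  The Riesz theorem, adjoints on a closed subspace and positive square roots are developed first, since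
  the adjoint and the square root are defined by descriptions.
\<close>

section \<open>Geometry of a complex inner product\<close>

lemma scaleC_one [simp]: "1 *\<^sub>C x = (x :: 'a::chilbert_space)"
  using scaleC_of_real[of 1 x] by simp

lemma scaleC_minus_one: "(- 1) *\<^sub>C x = - (x :: 'a::chilbert_space)"
  using scaleC_of_real[of "- 1" x] by simp

lemma scaleC_minus_left: "(- c) *\<^sub>C x = - (c *\<^sub>C (x :: 'a::chilbert_space))"
  by (metis scaleC_minus_one scaleC_scaleC mult_minus1)

lemma cinner_add_right: "cinner x (y + z) = cinner x y + cinner (x :: 'a::chilbert_space) z"
  by (metis cinner_commute cinner_add_left complex_cnj_add)

lemma cinner_scaleC_right: "cinner x (c *\<^sub>C y) = cnj c * cinner (x :: 'a::chilbert_space) y"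
  by (metis cinner_commute cinner_scaleC_left complex_cnj_mult)

lemma cinner_scaleR_left: "cinner (r *\<^sub>R x) y = r *\<^sub>R cinner (x :: 'a::chilbert_space) y"
  by (metis cinner_scaleC_left scaleC_of_real scaleR_conv_of_real)

lemma cinner_scaleR_right: "cinner x (r *\<^sub>R y) = r *\<^sub>R cinner (x :: 'a::chilbert_space) y"
  by (metis cinner_scaleC_right scaleC_of_real scaleR_conv_of_real complex_cnj_complex_of_real)

lemma norm_scaleC: "norm (c *\<^sub>C x) = cmod c * norm (x :: 'a::chilbert_space)"
proof -
  have "complex_of_real ((norm (c *\<^sub>C x))\<^sup>2) = c * cnj c * complex_of_real ((norm x)\<^sup>2)"
    unfolding cinner_self[symmetric] by (simp add: cinner_scaleC_left cinner_scaleC_right)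
  also have "\<dots> = complex_of_real ((cmod c * norm x)\<^sup>2)"
    by (simp add: power_mult_distrib flip: complex_norm_square)
  finally have "(norm (c *\<^sub>C x))\<^sup>2 = (cmod c * norm x)\<^sup>2"
    using of_real_eq_iff by blast
  then show ?thesis by (simp add: power2_eq_iff_nonneg)
qed

lemma norm_add_square:
  "(norm (x + y))\<^sup>2 = (norm x)\<^sup>2 + (norm y)\<^sup>2 + 2 * Re (cinner (x :: 'a::chilbert_space) y)"
proof -
  have "complex_of_real ((norm (x + y))\<^sup>2)
      = complex_of_real ((norm x)\<^sup>2) + complex_of_real ((norm y)\<^sup>2) + (cinner x y + cnj (cinner x y))"
    unfolding cinner_self[symmetric] cinner_commute[of y x, symmetric]
    by (simp add: cinner_add_left cinner_add_right)
  then have "complex_of_real ((norm (x + y))\<^sup>2)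
      = complex_of_real ((norm x)\<^sup>2 + (norm y)\<^sup>2 + 2 * Re (cinner x y))"
    by (simp add: complex_add_cnj)
  then show ?thesis using of_real_eq_iff by blast
qed

lemma nonneg_quadratic_linear_coeff_zero:
  fixes a c :: real
  assumes "\<And>t. t\<^sup>2 * a + 2 * t * c \<ge> 0"
  shows "c = 0"
proof (rule ccontr)
  assume "c \<noteq> 0"
  define s where "s = 1 / (\<bar>a\<bar> + 1)"
  have s: "s > 0" "s * a \<le> 1" by (auto simp: s_def field_simps)
  have "0 \<le> (- (s * c))\<^sup>2 * a + 2 * (- (s * c)) * c" by (rule assms)
  also have "\<dots> = s * c\<^sup>2 * (s * a - 2)" by (simp add: power2_eq_square algebra_simps)
  also have "\<dots> < 0" using s \<open>c \<noteq> 0\<close> by (intro mult_pos_neg) auto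
  finally show False by simp
qed

text \<open>
  The Cauchy--Schwarz inequality: the vector \<open>\<parallel>y\<parallel>\<^sup>2 x - \<langle>x, y\<rangle> y\<close>, a multiple of the component of
  \<open>x\<close> orthogonal to \<open>y\<close>, has a nonnegative squared norm.
\<close>

lemma cmod_cinner_le: "cmod (cinner x y) \<le> norm x * norm (y :: 'a::chilbert_space)"
proof (cases "norm y = 0")
  case True
  then have "y = 0" by simp
  then have "cinner x y = 0" using cinner_scaleR_right[of x 0 y] by simp
  then show ?thesis by simp
next
  case False
  define c where "c = cinner x y"
  define n where "n = (norm y)\<^sup>2"
  have n: "n > 0" using False by (simp add: n_def)
  have "0 \<le> (norm (n *\<^sub>R x + (- c) *\<^sub>C y))\<^sup>2" by simp
  also have "\<dots> = n\<^sup>2 * (norm x)\<^sup>2 + (cmod c)\<^sup>2 * n + 2 * Re (n *\<^sub>R ((- cnj c) * c))"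
    unfolding norm_add_square
    by (simp add: cinner_scaleR_left cinner_scaleC_right norm_scaleC power_mult_distrib
        c_def[symmetric] n_def)
  also have "Re (n *\<^sub>R ((- cnj c) * c)) = - n * (cmod c)\<^sup>2"
    unfolding cmod_power2 by (simp add: power2_eq_square)
  finally have "n * (cmod c)\<^sup>2 \<le> n * (n * (norm x)\<^sup>2)"
    by (simp add: algebra_simps power2_eq_square)
  then have "(cmod c)\<^sup>2 \<le> (norm x * norm y)\<^sup>2"
    using n by (simp add: n_def power_mult_distrib mult.commute)
  then show ?thesis
    unfolding c_def by (rule power2_le_imp_le) simp
qed

lemma bounded_bilinear_cinner:
  "bounded_bilinear (cinner :: 'a::chilbert_space \<Rightarrow> 'a \<Rightarrow> complex)"
  by (rule bounded_bilinear.intro)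
    (auto simp: cinner_add_left cinner_add_right cinner_scaleR_left cinner_scaleR_right
      intro!: exI[of _ 1] cmod_cinner_le)

interpretation cinner: bounded_bilinear "cinner :: 'a::chilbert_space \<Rightarrow> 'a \<Rightarrow> complex"
  by (rule bounded_bilinear_cinner)

lemma norm_diff_square:
  "(norm (x - y))\<^sup>2 = (norm x)\<^sup>2 + (norm y)\<^sup>2 - 2 * Re (cinner (x :: 'a::chilbert_space) y)"
  using norm_add_square[of x "- y"] by (simp add: cinner.minus_right)

lemma bounded_linear_scaleC: "bounded_linear (\<lambda>x :: 'a::chilbert_space. c *\<^sub>C x)"
proof (rule bounded_linear_intro)
  fix r :: real and x :: 'a
  show "c *\<^sub>C r *\<^sub>R x = r *\<^sub>R c *\<^sub>C x"
    by (simp add: scaleC_scaleC mult.commute flip: scaleC_of_real)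
  show "norm (c *\<^sub>C x) \<le> norm x * cmod c" by (simp add: norm_scaleC)
qed (rule scaleC_add_right)

lemmas tendsto_scaleC = bounded_linear.tendsto[OF bounded_linear_scaleC]

definition complex_subspace :: "'a::chilbert_space set \<Rightarrow> bool" where
  "complex_subspace M \<longleftrightarrow> 0 \<in> M \<and> (\<forall>x\<in>M. \<forall>y\<in>M. x + y \<in> M) \<and> (\<forall>c. \<forall>x\<in>M. c *\<^sub>C x \<in> M)"

text \<open>
  Linearity is only required on a subspace, because an operator on \<open>M\<close> carries no information
  outside \<open>M\<close>. The target space may differ from the domain, so that functionals are covered.
\<close>

definition complex_linear_on ::
    "'a::chilbert_space set \<Rightarrow> ('a \<Rightarrow> 'b::chilbert_space) \<Rightarrow> bool" where
  "complex_linear_on M f \<longleftrightarrow>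
     (\<forall>x\<in>M. \<forall>y\<in>M. f (x + y) = f x + f y) \<and> (\<forall>c. \<forall>x\<in>M. f (c *\<^sub>C x) = c *\<^sub>C f x)"

lemma complex_linear_onI:
  assumes "\<And>x y. x \<in> M \<Longrightarrow> y \<in> M \<Longrightarrow> f (x + y) = f x + f y"
    and "\<And>c x. x \<in> M \<Longrightarrow> f (c *\<^sub>C x) = c *\<^sub>C f x"
  shows "complex_linear_on M f"
  using assms by (simp add: complex_linear_on_def)

lemma complex_linear_onD:
  assumes "complex_linear_on M f"
  shows "x \<in> M \<Longrightarrow> y \<in> M \<Longrightarrow> f (x + y) = f x + f y"
    and "x \<in> M \<Longrightarrow> f (c *\<^sub>C x) = c *\<^sub>C f x"
    and "x \<in> M \<Longrightarrow> f (r *\<^sub>R x) = r *\<^sub>R f x"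
  using assms unfolding complex_linear_on_def by (auto simp flip: scaleC_of_real)

lemma complex_subspace_UNIV [simp]: "complex_subspace UNIV"
  by (simp add: complex_subspace_def)

lemma complex_subspaceD:
  assumes "complex_subspace M"
  shows "0 \<in> M" and "x \<in> M \<Longrightarrow> y \<in> M \<Longrightarrow> x + y \<in> M" and "x \<in> M \<Longrightarrow> c *\<^sub>C x \<in> M"
    and "x \<in> M \<Longrightarrow> r *\<^sub>R x \<in> M" and "x \<in> M \<Longrightarrow> y \<in> M \<Longrightarrow> x - y \<in> M"
proof -
  show *: "0 \<in> M" "x \<in> M \<Longrightarrow> y \<in> M \<Longrightarrow> x + y \<in> M" "x \<in> M \<Longrightarrow> c *\<^sub>C x \<in> M" for x y c
    using assms by (auto simp: complex_subspace_def)
  show "x \<in> M \<Longrightarrow> r *\<^sub>R x \<in> M" using *(3) by (metis scaleC_of_real)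
  show "x \<in> M \<Longrightarrow> y \<in> M \<Longrightarrow> x - y \<in> M"
    using *(2)[of x "- y"] *(3)[of y "- 1"] by (simp add: scaleC_minus_one)
qed

lemma complex_subspace_image:
  assumes "complex_subspace S" "complex_linear_on S D"
  shows "complex_subspace (D ` S)"
  unfolding complex_subspace_def
proof (intro conjI ballI allI)
  have "D 0 = 0"
    using complex_linear_onD(3)[OF assms(2), of 0 0] complex_subspaceD(1)[OF assms(1)] by simp
  then show "0 \<in> D ` S" using complex_subspaceD(1)[OF assms(1)] by (metis image_eqI)
next
  fix x y assume "x \<in> D ` S" "y \<in> D ` S"
  then obtain a b where "x = D a" "y = D b" "a \<in> S" "b \<in> S" by auto
  then show "x + y \<in> D ` S"
    using complex_linear_onD(1)[OF assms(2)] complex_subspaceD(2)[OF assms(1)] by (metis image_eqI)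
next
  fix c x assume "x \<in> D ` S"
  then obtain a where "x = D a" "a \<in> S" by auto
  then show "c *\<^sub>C x \<in> D ` S"
    using complex_linear_onD(2)[OF assms(2)] complex_subspaceD(3)[OF assms(1)] by (metis image_eqI)
qed

lemma complex_subspace_closure:
  assumes "complex_subspace S"
  shows "complex_subspace (closure S)"
  unfolding complex_subspace_def
proof (intro conjI ballI allI)
  show "0 \<in> closure S" using complex_subspaceD(1)[OF assms] closure_subset by blast
next
  fix x y assume "x \<in> closure S" "y \<in> closure S"
  then obtain f g where "\<And>n::nat. f n \<in> S" "f \<longlonglongrightarrow> x" "\<And>n::nat. g n \<in> S" "g \<longlonglongrightarrow> y"
    by (auto simp: closure_sequential)
  then have "(\<lambda>n. f n + g n) \<longlonglongrightarrow> x + y" "\<forall>n. f n + g n \<in> S"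
    using complex_subspaceD(2)[OF assms] by (auto intro: tendsto_add)
  then show "x + y \<in> closure S" unfolding closure_sequential by (intro exI conjI)
next
  fix c x assume "x \<in> closure S"
  then obtain f where "\<And>n::nat. f n \<in> S" "f \<longlonglongrightarrow> x" by (auto simp: closure_sequential)
  then have "(\<lambda>n. c *\<^sub>C f n) \<longlonglongrightarrow> c *\<^sub>C x" "\<forall>n. c *\<^sub>C f n \<in> S"
    using complex_subspaceD(3)[OF assms] by (auto intro: tendsto_scaleC)
  then show "c *\<^sub>C x \<in> closure S" unfolding closure_sequential by (intro exI conjI)
qed

text \<open>
  A vector in the closure of a subspace is the limit of vectors of the subspace; if it is orthogonal
  to all of these, then it is orthogonal to itself. Identities between vectors of the defect space are
  therefore tested against vectors in the range of the defect operator.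
\<close>

lemma eq_in_closure_if_cinner_eq:
  assumes "complex_subspace S" "u \<in> closure S" "v \<in> closure S"
    and "\<And>s. s \<in> S \<Longrightarrow> cinner u s = cinner v s"
  shows "u = v"
proof -
  have "u - v \<in> closure S"
    using complex_subspaceD(5)[OF complex_subspace_closure] assms by blast
  then obtain f where f: "\<And>n::nat. f n \<in> S" "f \<longlonglongrightarrow> u - v" by (auto simp: closure_sequential)
  have "(\<lambda>n. cinner (u - v) (f n)) \<longlonglongrightarrow> cinner (u - v) (u - v)"
    by (intro cinner.tendsto tendsto_const f)
  moreover have "cinner (u - v) (f n) = 0" for n
    using assms(4)[OF f(1)] by (simp add: cinner.diff_left)
  ultimately have "cinner (u - v) (u - v) = 0" by (simp add: LIMSEQ_const_iff)
  then show ?thesis by (simp add: cinner_self)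
qed

lemma eq_if_cinner_eq:
  assumes "\<And>s. cinner u s = cinner v s"
  shows "u = v"
  using eq_in_closure_if_cinner_eq[of UNIV u v] assms by simp

section \<open>Representation of functionals and forms\<close>

text \<open>
  The Riesz representation theorem, in a form that also covers functionals dominated by a seminorm
  \<open>\<parallel>D b\<parallel>\<close>; taking the identity for \<open>D\<close> gives the usual theorem. Since \<open>\<phi>\<close> factors through \<open>D\<close>, the
  quadratic functional \<open>\<parallel>D b\<parallel>\<^sup>2 - 2 Re \<phi>(b)\<close> is bounded below, and the vector sought is the limit of
  \<open>D b\<^sub>n\<close> along a minimising sequence, whether or not the sequence \<open>b\<^sub>n\<close> itself converges.
\<close>

lemma functional_representation:
  fixes D :: "'a::chilbert_space \<Rightarrow> 'a" and \<phi> :: "'a \<Rightarrow> complex"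
  assumes S: "complex_subspace S" and D: "complex_linear_on S D"
    and \<phi>: "complex_linear_on S \<phi>"
    and bound: "\<And>b. b \<in> S \<Longrightarrow> cmod (\<phi> b) \<le> K * norm (D b)" and K: "K \<ge> 0"
  shows "\<exists>u\<in>closure (D ` S). norm u \<le> K \<and> (\<forall>b\<in>S. cinner (D b) u = \<phi> b)"
proof -
  define J where "J b = (norm (D b))\<^sup>2 - 2 * Re (\<phi> b)" for b
  define I where "I = Inf (J ` S)"
  have J_add: "J (a + t *\<^sub>R b) = J a + t\<^sup>2 * (norm (D b))\<^sup>2 + 2 * t * (Re (cinner (D a) (D b)) - Re (\<phi> b))"
    if "a \<in> S" "b \<in> S" for a b t
    using that complex_subspaceD(4)[OF S]
    by (simp add: J_def complex_linear_onD[OF D] complex_linear_onD[OF \<phi>] norm_add_square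
        cinner_scaleR_right power_mult_distrib algebra_simps)
  have J_lower: "- K\<^sup>2 \<le> J b" if "b \<in> S" for b
  proof -
    have "Re (\<phi> b) \<le> K * norm (D b)"
      using bound[OF that] complex_Re_le_cmod order_trans by blast
    then have "(norm (D b) - K)\<^sup>2 - K\<^sup>2 \<le> J b"
      by (simp add: J_def power2_eq_square algebra_simps)
    then show ?thesis by (smt (verit) zero_le_power2)
  qed
  then have bdd: "bdd_below (J ` S)" by (auto intro!: bdd_belowI2)
  have I_le: "I \<le> J b" if "b \<in> S" for b
    unfolding I_def using that bdd by (simp add: cINF_lower)
  have "\<exists>b\<in>S. J b < I + 1 / real (Suc n)" for n
  proof -
    have "Inf (J ` S) < I + 1 / real (Suc n)" by (simp add: I_def)
    then show ?thesis
      using cInf_less_iff[of "J ` S"] bdd complex_subspaceD(1)[OF S] by blast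
  qed
  then obtain b where b: "\<And>n. b n \<in> S" "\<And>n. J (b n) < I + 1 / real (Suc n)" by metis
  \<comment> \<open>The parallelogram law makes the images of a minimising sequence a Cauchy sequence.\<close>
  have close: "(norm (D (b m) - D (b n)))\<^sup>2 \<le> 2 / real (Suc m) + 2 / real (Suc n)" for m n
  proof -
    define c where "c = (1/2) *\<^sub>R (b m + b n)"
    have "c \<in> S" unfolding c_def using b complex_subspaceD[OF S] by simp
    have Dc: "D c = (1/2) *\<^sub>R (D (b m) + D (b n))" "\<phi> c = (1/2) *\<^sub>R (\<phi> (b m) + \<phi> (b n))"
      unfolding c_def
      using b complex_subspaceD[OF S]
      by (simp_all add: complex_linear_onD[OF D] complex_linear_onD[OF \<phi>])
    have "(norm (D (b m) - D (b n)))\<^sup>2 = 2 * J (b m) + 2 * J (b n) - 4 * J c"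
      by (simp add: J_def Dc norm_diff_square power_divide norm_add_square cinner_scaleR_left cinner_scaleR_right field_simps)
    then show ?thesis using I_le[OF \<open>c \<in> S\<close>] b(2)[of m] b(2)[of n] by argo
  qed
  have "Cauchy (\<lambda>n. D (b n))"
  proof (rule metric_CauchyI)
    fix e :: real assume e: "e > 0"
    obtain N where N: "4 / e\<^sup>2 < real N" using reals_Archimedean2 by blast
    have "dist (D (b m)) (D (b n)) < e" if "m \<ge> N" "n \<ge> N" for m n
    proof -
      have p: "2 / real (Suc k) < e\<^sup>2 / 2" if "k \<ge> N" for k
      proof -
        have "4 / e\<^sup>2 < real (Suc k)" using N that by linarith
        then show ?thesis using e by (simp add: field_simps)
      qed
      have "(norm (D (b m) - D (b n)))\<^sup>2 < e\<^sup>2"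
        using close[of m n] p[OF that(1)] p[OF that(2)] by linarith
      then show ?thesis using e by (simp add: dist_norm power2_less_imp_less)
    qed
    then show "\<exists>M. \<forall>m\<ge>M. \<forall>n\<ge>M. dist (D (b m)) (D (b n)) < e" by blast
  qed
  then obtain u where u: "(\<lambda>n. D (b n)) \<longlonglongrightarrow> u"
    using Cauchy_convergent convergentD by blast
  have uS: "u \<in> closure (D ` S)" unfolding closure_sequential
    using u b(1) by (intro exI[of _ "\<lambda>n. D (b n)"]) auto
  \<comment> \<open>The first variation of \<open>J\<close> vanishes at the minimum.\<close>
  have re: "Re (cinner (D y) u) = Re (\<phi> y)" if y: "y \<in> S" for y
  proof -
    have "0 \<le> t\<^sup>2 * (norm (D y))\<^sup>2 + 2 * t * (Re (cinner u (D y)) - Re (\<phi> y))" for t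
    proof (rule LIMSEQ_le_const)
      have "(\<lambda>n. 1 / real (Suc n)) \<longlonglongrightarrow> 0" by (rule LIMSEQ_Suc[OF lim_inverse_n'])
      moreover have "(\<lambda>n. t\<^sup>2 * (norm (D y))\<^sup>2 + 2 * t * (Re (cinner (D (b n)) (D y)) - Re (\<phi> y)))
          \<longlonglongrightarrow> t\<^sup>2 * (norm (D y))\<^sup>2 + 2 * t * (Re (cinner u (D y)) - Re (\<phi> y))"
        by (intro tendsto_intros cinner.tendsto u)
      ultimately show "(\<lambda>n. 1 / real (Suc n) + (t\<^sup>2 * (norm (D y))\<^sup>2 + 2 * t * (Re (cinner (D (b n)) (D y)) - Re (\<phi> y))))
          \<longlonglongrightarrow> t\<^sup>2 * (norm (D y))\<^sup>2 + 2 * t * (Re (cinner u (D y)) - Re (\<phi> y))"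
        using tendsto_add by fastforce
      have "0 \<le> 1 / real (Suc n) + (t\<^sup>2 * (norm (D y))\<^sup>2 + 2 * t * (Re (cinner (D (b n)) (D y)) - Re (\<phi> y)))" for n
      proof -
        have "b n + t *\<^sub>R y \<in> S" using b y complex_subspaceD[OF S] by simp
        then show ?thesis using I_le J_add[OF b(1) y, of n t] b(2)[of n] by (smt (verit))
      qed
      then show "\<exists>N. \<forall>n\<ge>N. 0 \<le> 1 / real (Suc n) + (t\<^sup>2 * (norm (D y))\<^sup>2 + 2 * t * (Re (cinner (D (b n)) (D y)) - Re (\<phi> y)))"
        by blast
    qed
    then have "Re (cinner u (D y)) - Re (\<phi> y) = 0" by (rule nonneg_quadratic_linear_coeff_zero)
    then show ?thesis by (subst cinner_commute) simp
  qed
  have eq: "cinner (D y) u = \<phi> y" if y: "y \<in> S" for y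
  proof (rule complex_eqI)
    show "Re (cinner (D y) u) = Re (\<phi> y)" using re[OF y] .
    have "Re (cinner (D (\<i> *\<^sub>C y)) u) = Re (\<phi> (\<i> *\<^sub>C y))"
      using y complex_subspaceD(3)[OF S] by (intro re) simp
    then show "Im (cinner (D y) u) = Im (\<phi> y)"
      using y by (simp add: complex_linear_onD[OF D] complex_linear_onD[OF \<phi>] cinner_scaleC_left
          scaleC_complex_def)
  qed
  have "(norm u)\<^sup>2 \<le> K * norm u"
  proof (rule LIMSEQ_le)
    have "(\<lambda>n. Re (cinner (D (b n)) u)) \<longlonglongrightarrow> Re (cinner u u)"
      by (intro tendsto_Re cinner.tendsto tendsto_const u)
    then show "(\<lambda>n. Re (cinner (D (b n)) u)) \<longlonglongrightarrow> (norm u)\<^sup>2" by (simp add: cinner_self)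
    show "(\<lambda>n. K * norm (D (b n))) \<longlonglongrightarrow> K * norm u" by (intro tendsto_intros u)
    show "\<exists>N. \<forall>n\<ge>N. Re (cinner (D (b n)) u) \<le> K * norm (D (b n))"
      using bound[OF b(1)] complex_Re_le_cmod order_trans eq[OF b(1)] by metis
  qed
  then have "norm u \<le> K" using K by (cases "norm u = 0") (auto simp: power2_eq_square)
  then show ?thesis using uS eq by blast
qed

text \<open>
  The representing vector of a sesquilinear form depends linearly on its second argument. The three
  later uses of this lemma take for \<open>D\<close> either the inclusion of a closed subspace, which gives adjoints,
  or a self-adjoint operator through which a given operator is to be factored.
\<close>

lemma form_representation:
  fixes D :: "'a::chilbert_space \<Rightarrow> 'a" and \<phi> :: "'a \<Rightarrow> 'a \<Rightarrow> complex"
  assumes S: "complex_subspace S" and D: "complex_linear_on S D" and W: "complex_subspace W"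
    and lin: "\<And>y. y \<in> W \<Longrightarrow> complex_linear_on S (\<lambda>x. \<phi> x y)"
    and conj: "\<And>x. x \<in> S \<Longrightarrow> complex_linear_on W (\<lambda>y. cnj (\<phi> x y))"
    and bound: "\<And>x y. x \<in> S \<Longrightarrow> y \<in> W \<Longrightarrow> cmod (\<phi> x y) \<le> n y * norm (D x)"
    and n: "\<And>y. n y \<ge> (0 :: real)"
  shows "\<exists>V. (\<forall>y\<in>W. V y \<in> closure (D ` S) \<and> norm (V y) \<le> n y) \<and> complex_linear_on W V \<and>
    (\<forall>x\<in>S. \<forall>y\<in>W. cinner (D x) (V y) = \<phi> x y)"
proof -
  have "\<forall>y\<in>W. \<exists>u\<in>closure (D ` S). norm u \<le> n y \<and> (\<forall>x\<in>S. cinner (D x) u = \<phi> x y)"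
    using functional_representation[OF S D lin bound n] by blast
  then obtain V where V: "\<And>y. y \<in> W \<Longrightarrow> V y \<in> closure (D ` S)" "\<And>y. y \<in> W \<Longrightarrow> norm (V y) \<le> n y"
      "\<And>x y. y \<in> W \<Longrightarrow> x \<in> S \<Longrightarrow> cinner (D x) (V y) = \<phi> x y"
    by metis
  have DS: "complex_subspace (D ` S)" using S D by (rule complex_subspace_image)
  note cl = complex_subspaceD[OF complex_subspace_closure[OF DS]] complex_subspaceD[OF W]
  have V': "cinner (V y) (D x) = cnj (\<phi> x y)" if "y \<in> W" "x \<in> S" for x y
    using V(3)[OF that] by (metis cinner_commute)
  have "complex_linear_on W V"
  proof (rule complex_linear_onI)
    fix x y assume xy: "x \<in> W" "y \<in> W"
    show "V (x + y) = V x + V y"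
    proof (rule eq_in_closure_if_cinner_eq[OF DS])
      show "V (x + y) \<in> closure (D ` S)" "V x + V y \<in> closure (D ` S)" using V xy cl by auto
      fix s assume "s \<in> D ` S"
      then obtain a where "s = D a" "a \<in> S" by auto
      then show "cinner (V (x + y)) s = cinner (V x + V y) s"
        using xy cl complex_linear_onD(1)[OF conj, of a x y] by (simp add: cinner_add_left V')
    qed
  next
    fix c x assume x: "x \<in> W"
    show "V (c *\<^sub>C x) = c *\<^sub>C V x"
    proof (rule eq_in_closure_if_cinner_eq[OF DS])
      show "V (c *\<^sub>C x) \<in> closure (D ` S)" "c *\<^sub>C V x \<in> closure (D ` S)" using V x cl by auto
      fix s assume "s \<in> D ` S"
      then obtain a where "s = D a" "a \<in> S" by auto
      then show "cinner (V (c *\<^sub>C x)) s = cinner (c *\<^sub>C V x) s"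
        using x cl complex_linear_onD(2)[OF conj, of a x c]
        by (simp add: cinner_scaleC_left scaleC_complex_def V')
    qed
  qed
  then show ?thesis using V by blast
qed

section \<open>Operators on a closed subspace\<close>

lemma bounded_opsD:
  assumes "X \<in> bounded_ops M"
  shows "x \<in> M \<Longrightarrow> X x \<in> M" and "x \<notin> M \<Longrightarrow> X x = undefined"
    and "complex_linear_on M X" and "\<exists>K\<ge>0. \<forall>x\<in>M. norm (X x) \<le> K * norm x"
proof -
  show "x \<in> M \<Longrightarrow> X x \<in> M" and "x \<notin> M \<Longrightarrow> X x = undefined" and "complex_linear_on M X"
    using assms by (auto simp: bounded_ops_def complex_linear_on_def PiE_def extensional_def)
  obtain K where K: "\<forall>x\<in>M. norm (X x) \<le> K * norm x" using assms by (auto simp: bounded_ops_def)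
  have "norm (X x) \<le> \<bar>K\<bar> * norm x" if "x \<in> M" for x
    using K that by (smt (verit) abs_ge_self mult_right_mono norm_ge_zero)
  then show "\<exists>K\<ge>0. \<forall>x\<in>M. norm (X x) \<le> K * norm x" by (intro exI[of _ "\<bar>K\<bar>"]) auto
qed

lemma restrict_in_bounded_ops:
  assumes "complex_subspace M" "complex_linear_on M X"
    and "\<And>x. x \<in> M \<Longrightarrow> X x \<in> M" "\<And>x. x \<in> M \<Longrightarrow> norm (X x) \<le> K * norm x"
  shows "restrict X M \<in> bounded_ops M"
  using assms(2-4) complex_subspaceD[OF assms(1)]
  by (auto simp: bounded_ops_def complex_linear_on_def intro!: exI[of _ K])

lemma bounded_opsI:
  assumes "complex_linear_on UNIV X" and "\<And>x. norm (X x) \<le> K * norm x"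
  shows "X \<in> bounded_ops UNIV"
  using restrict_in_bounded_ops[of UNIV X K] assms by (simp add: restrict_UNIV)

lemma bounded_linear_if_bounded_ops:
  assumes "X \<in> bounded_ops UNIV"
  shows "bounded_linear X"
proof -
  obtain K where K: "\<forall>x. norm (X x) \<le> K * norm x" using bounded_opsD(4)[OF assms] by auto
  show ?thesis
    using complex_linear_onD[OF bounded_opsD(3)[OF assms]] K
    by (intro bounded_linear_intro[where K = K]) (auto simp: mult.commute)
qed

text \<open>
  The adjoint is a definite description, so nothing is known about it before the existence and
  uniqueness shown here.
\<close>

lemma adj_on:
  assumes M: "complex_subspace M" and cl: "closed M" and X: "X \<in> bounded_ops M"
  shows "adj_on M X \<in> bounded_ops M"
    and "x \<in> M \<Longrightarrow> y \<in> M \<Longrightarrow> cinner (X x) y = cinner x (adj_on M X y)"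
proof -
  obtain K where K: "K \<ge> 0" "\<And>x. x \<in> M \<Longrightarrow> norm (X x) \<le> K * norm x"
    using bounded_opsD(4)[OF X] by blast
  have bound: "cmod (cinner (X x) y) \<le> K * norm y * norm x" if "x \<in> M" for x y
  proof -
    have "cmod (cinner (X x) y) \<le> norm (X x) * norm y" by (rule cmod_cinner_le)
    also have "\<dots> \<le> K * norm x * norm y" by (intro mult_right_mono K that) simp
    finally show ?thesis by (simp add: mult_ac)
  qed
  have lin: "complex_linear_on M (\<lambda>x. cinner (X x) y)" for y
    using complex_linear_onD[OF bounded_opsD(3)[OF X]]
    by (intro complex_linear_onI)
      (auto simp: cinner_add_left cinner_scaleC_left scaleC_complex_def)
  have conj: "complex_linear_on M (\<lambda>y. cnj (cinner (X x) y))" for x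
    by (intro complex_linear_onI)
      (auto simp: cinner_add_right cinner_scaleC_right scaleC_complex_def)
  have "\<exists>V. (\<forall>y\<in>M. V y \<in> closure ((\<lambda>x. x) ` M) \<and> norm (V y) \<le> K * norm y) \<and> complex_linear_on M V \<and>
    (\<forall>x\<in>M. \<forall>y\<in>M. cinner x (V y) = cinner (X x) y)"
    by (rule form_representation[OF M _ M lin conj bound])
      (auto simp: K(1) intro!: complex_linear_onI)
  then obtain V where V: "\<forall>y\<in>M. V y \<in> M \<and> norm (V y) \<le> K * norm y" "complex_linear_on M V"
     "\<forall>x\<in>M. \<forall>y\<in>M. cinner x (V y) = cinner (X x) y"
    using cl by auto
  let ?P = "\<lambda>Y. Y \<in> bounded_ops M \<and> (\<forall>x\<in>M. \<forall>y\<in>M. cinner (X x) y = cinner x (Y y))"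
  have ex: "?P (restrict V M)"
    using restrict_in_bounded_ops[OF M V(2)] V by auto
  have uniq: "Y = Z" if Y: "?P Y" and Z: "?P Z" for Y Z
  proof
    fix y show "Y y = Z y"
    proof (cases "y \<in> M")
      case True
      have "cinner (Y y) x = cinner (Z y) x" if "x \<in> M" for x
        using Y Z True that by (metis cinner_commute)
      then show ?thesis
        using eq_in_closure_if_cinner_eq[OF M, of "Y y" "Z y"] Y Z True bounded_opsD(1) closure_subset
        by blast
    next
      case False
      then show ?thesis using Y Z bounded_opsD(2) by metis
    qed
  qed
  have "?P (adj_on M X)"
    unfolding adj_on_def by (rule theI2[of ?P, OF ex]) (use uniq ex in blast)+
  then show "adj_on M X \<in> bounded_ops M"
    and "x \<in> M \<Longrightarrow> y \<in> M \<Longrightarrow> cinner (X x) y = cinner x (adj_on M X y)" by auto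
qed

lemmas adj_in_bounded_ops = adj_on(1)[OF complex_subspace_UNIV closed_UNIV]

lemma cinner_adj:
  assumes "X \<in> bounded_ops UNIV"
  shows "cinner x (adj X y) = cinner (X x) y" and "cinner (adj X y) x = cinner y (X x)"
proof -
  show eq: "cinner x (adj X y) = cinner (X x) y"
    using adj_on(2)[OF complex_subspace_UNIV closed_UNIV assms, of x y] by simp
  show "cinner (adj X y) x = cinner y (X x)"
    unfolding cinner_commute[of "adj X y"] cinner_commute[of y] eq ..
qed

section \<open>Positive square roots and the defect operator\<close>

text \<open>
  If \<open>Y\<close> is a fixed point of \<open>Y \<mapsto> (A + Y\<^sup>2) / 2\<close>, then \<open>(I - Y)\<^sup>2 = I - A\<close>. For a contraction \<open>A\<close>
  the iteration started at zero converges in operator norm to such a \<open>Y\<close>, because it is majorised by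
  the scalar iteration for \<open>A = 1\<close>, which increases and is bounded by 1. This produces square roots
  without a spectral theorem.
\<close>

primrec root_iter :: "('a::real_normed_vector \<Rightarrow>\<^sub>L 'a) \<Rightarrow> nat \<Rightarrow> 'a \<Rightarrow>\<^sub>L 'a" where
  "root_iter A 0 = 0"
| "root_iter A (Suc n) = (1/2) *\<^sub>R (A + (root_iter A n o\<^sub>L root_iter A n))"

primrec root_majorant :: "nat \<Rightarrow> real" where
  "root_majorant 0 = 0"
| "root_majorant (Suc n) = (1 + (root_majorant n)\<^sup>2) / 2"

lemma root_majorant_bounds: "0 \<le> root_majorant n \<and> root_majorant n \<le> 1"
  by (induction n) (auto simp: power_le_one)

lemma root_majorant_Suc_diff:
  "root_majorant (Suc (Suc n)) - root_majorant (Suc n) =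
   (root_majorant (Suc n) + root_majorant n) * (root_majorant (Suc n) - root_majorant n) / 2"
  by (simp add: power2_eq_square algebra_simps add_divide_distrib diff_divide_distrib)

lemma norm_root_iter_le:
  assumes "norm A \<le> 1"
  shows "norm (root_iter A n) \<le> root_majorant n"
proof (induction n)
  case (Suc n)
  have "norm (root_iter A n o\<^sub>L root_iter A n) \<le> norm (root_iter A n) * norm (root_iter A n)"
    by (rule norm_blinfun_compose)
  also have "\<dots> \<le> root_majorant n * root_majorant n"
    using Suc root_majorant_bounds by (intro mult_mono) auto
  finally have "norm (A + (root_iter A n o\<^sub>L root_iter A n)) \<le> 1 + (root_majorant n)\<^sup>2"
    by (intro norm_triangle_le add_mono assms) (simp add: power2_eq_square)
  then show ?case by simp
qed simp

lemma norm_root_iter_diff_le: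
  assumes "norm A \<le> 1"
  shows "norm (root_iter A (Suc n) - root_iter A n) \<le> root_majorant (Suc n) - root_majorant n"
proof (induction n)
  case 0 show ?case using assms by simp
next
  case (Suc n)
  let ?X = "root_iter A (Suc n)" and ?Y = "root_iter A n"
  note b = norm_root_iter_le[OF assms]
  have "root_iter A (Suc (Suc n)) - ?X
      = (1/2) *\<^sub>R (A + (?X o\<^sub>L ?X)) - (1/2) *\<^sub>R (A + (?Y o\<^sub>L ?Y))"
    by simp
  also have "\<dots> = (1/2) *\<^sub>R ((?X o\<^sub>L ?X) - (?Y o\<^sub>L ?Y))"
    unfolding scaleR_right_diff_distrib[symmetric] add_diff_cancel_left ..
  also have "(?X o\<^sub>L ?X) - (?Y o\<^sub>L ?Y) = (?X o\<^sub>L (?X - ?Y)) + ((?X - ?Y) o\<^sub>L ?Y)"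
    by (rule blinfun_eqI) (simp add: blinfun.bilinear_simps del: root_iter.simps)
  finally have "norm (root_iter A (Suc (Suc n)) - ?X)
      \<le> (norm (?X o\<^sub>L (?X - ?Y)) + norm ((?X - ?Y) o\<^sub>L ?Y)) / 2"
    using norm_triangle_ineq by (simp del: root_iter.simps)
  also have "\<dots> \<le> (norm ?X * norm (?X - ?Y) + norm (?X - ?Y) * norm ?Y) / 2"
    by (intro divide_right_mono add_mono norm_blinfun_compose) simp
  also have "\<dots> = (norm ?X + norm ?Y) * norm (?X - ?Y) / 2" by (simp add: algebra_simps)
  also have "\<dots> \<le> (root_majorant (Suc n) + root_majorant n) * (root_majorant (Suc n) - root_majorant n) / 2"
    using b[of n] b[of "Suc n"] Suc root_majorant_bounds
    by (intro divide_right_mono mult_mono add_mono) (auto simp del: root_iter.simps root_majorant.simps)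
  finally show ?case by (simp only: root_majorant_Suc_diff)
qed

lemma root_iter_convergent:
  fixes A :: "'a::banach \<Rightarrow>\<^sub>L 'a"
  assumes "norm A \<le> 1"
  shows "convergent (root_iter A)"
proof -
  have summ: "summable (\<lambda>n. root_majorant (Suc n) - root_majorant n)"
  proof -
    have "root_majorant n \<le> root_majorant (Suc n)" for n
      using norm_root_iter_diff_le[OF assms, of n] norm_ge_zero order_trans by (smt (verit))
    then have "convergent root_majorant"
      using root_majorant_bounds
      by (metis incseq_SucI incseq_convergent convergentI)
    then show ?thesis using telescope_summable convergentD by blast
  qed
  have "summable (\<lambda>n. root_iter A (Suc n) - root_iter A n)"
    by (rule summable_comparison_test'[OF summ, of 0]) (rule norm_root_iter_diff_le[OF assms])
  then have "convergent (\<lambda>n. \<Sum>k<n. root_iter A (Suc k) - root_iter A k)"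
    by (simp only: summable_iff_convergent)
  then show ?thesis by (simp add: sum_lessThan_telescope del: root_iter.simps(2))
qed

text \<open>
  Commuting with multiplication by a complex scalar is complex linearity, so one statement yields
  both that the limit is complex linear and that it commutes with every other square root.
\<close>

lemma root_iter_commute:
  fixes A :: "'a::real_normed_vector \<Rightarrow>\<^sub>L 'a"
  assumes "\<And>x. A (B x) = B (A x)" "linear B"
  shows "root_iter A n (B x) = B (root_iter A n x)"
  using assms(2)
  by (induction n arbitrary: x)
    (simp_all add: linear_0 linear_add linear_scale blinfun.bilinear_simps assms(1))

lemma root_iter_symmetric:
  fixes A :: "'a::chilbert_space \<Rightarrow>\<^sub>L 'a"
  assumes "\<And>x y. cinner (A x) y = cinner x (A y)"
  shows "cinner (root_iter A n x) y = cinner x (root_iter A n y)"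
  by (induction n arbitrary: x y)
    (simp_all add: blinfun.bilinear_simps cinner.zero_left cinner.zero_right cinner_scaleR_left
      cinner_scaleR_right cinner_add_left cinner_add_right assms)

lemma positive_opD:
  assumes "positive_op S"
  shows "S \<in> bounded_ops UNIV" and "Re (cinner (S x) x) \<ge> 0" and "Im (cinner (S x) x) = 0"
  using assms by (auto simp: positive_op_def complex_nonneg_Reals_iff)

text \<open>
  Polarisation: the quadratic form is real at \<open>x + y\<close> and at \<open>x + i y\<close>, which identifies the
  imaginary and the real part of the two mixed terms.
\<close>

lemma positive_op_symmetric:
  assumes "positive_op S"
  shows "cinner (S x) y = cinner x (S y)"
proof -
  note lin = complex_linear_onD[OF bounded_opsD(3)[OF positive_opD(1)[OF assms]], simplified]
  note im = positive_opD(3)[OF assms]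
  have "Im (cinner (S x) y) + Im (cinner (S y) x) = 0"
    using im[of "x + y"] im[of x] im[of y]
    by (simp add: lin(1) cinner_add_left cinner_add_right)
  moreover have "Re (cinner (S y) x) - Re (cinner (S x) y) = 0"
    using im[of "x + \<i> *\<^sub>C y"] im[of x] im[of y]
    by (simp add: lin(1,2) cinner_add_left cinner_add_right cinner_scaleC_left cinner_scaleC_right)
  ultimately have "cinner (S x) y = cnj (cinner (S y) x)" by (auto intro!: complex_eqI)
  then show ?thesis using cinner_commute by metis
qed

text \<open>
  The quadratic form of \<open>S\<close> is minimal at \<open>y\<close>, so its first variation in the direction \<open>S y\<close>, which
  is a multiple of \<open>\<parallel>S y\<parallel>\<^sup>2\<close>, vanishes.
\<close>

lemma positive_op_kernel:
  assumes S: "positive_op S" and "Re (cinner (S y) y) = 0"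
  shows "S y = 0"
proof -
  note lin = complex_linear_onD[OF bounded_opsD(3)[OF positive_opD(1)[OF S]], simplified]
  have "0 \<le> t\<^sup>2 * Re (cinner (S (S y)) (S y)) + 2 * t * (norm (S y))\<^sup>2" for t
    using positive_opD(2)[OF S, of "y + t *\<^sub>R S y"] assms(2)
    by (simp add: lin cinner_add_left cinner_add_right cinner_scaleR_left cinner_scaleR_right
        positive_op_symmetric[OF S, of "S y" y] cinner_self power2_eq_square algebra_simps)
  then have "(norm (S y))\<^sup>2 = 0" by (rule nonneg_quadratic_linear_coeff_zero)
  then show ?thesis by simp
qed

text \<open>
  Since the roots commute, with \<open>y = (S - R) x\<close> the sum \<open>(S + R) y = (S\<^sup>2 - R\<^sup>2) x\<close> vanishes, hence so do the two nonnegative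
  numbers \<open>\<langle>S y, y\<rangle>\<close> and \<open>\<langle>R y, y\<rangle>\<close>. Then \<open>S y = R y = 0\<close>, and \<open>\<parallel>y\<parallel>\<^sup>2 = \<langle>x, (S - R) y\<rangle> = 0\<close>.
\<close>

lemma positive_root_unique:
  assumes S: "positive_op S" and R: "positive_op R" and sq: "\<And>x. S (S x) = R (R x)"
    and comm: "\<And>x. S (R x) = R (S x)"
  shows "S = R"
proof
  fix x
  note linS = bounded_linear_if_bounded_ops[OF positive_opD(1)[OF S], THEN bounded_linear.linear]
  note linR = bounded_linear_if_bounded_ops[OF positive_opD(1)[OF R], THEN bounded_linear.linear]
  define y where "y = S x - R x"
  have "S y + R y = 0"
    by (simp add: y_def linear_diff[OF linS] linear_diff[OF linR] sq comm)
  then have "cinner (S y) y + cinner (R y) y = 0" by (metis cinner_add_left cinner.zero_left)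
  then have "Re (cinner (S y) y) + Re (cinner (R y) y) = 0"
    by (metis plus_complex.sel(1) zero_complex.sel(1))
  then have "Re (cinner (S y) y) = 0" "Re (cinner (R y) y) = 0"
    using positive_opD(2)[OF S, of y] positive_opD(2)[OF R, of y] by linarith+
  then have "S y = 0" "R y = 0" by (blast intro: positive_op_kernel[OF S] positive_op_kernel[OF R])+
  then have "cinner (S x) y = 0" "cinner (R x) y = 0"
    using positive_op_symmetric[OF S, of x y] positive_op_symmetric[OF R, of x y]
    by (simp_all add: cinner.zero_right)
  then have "cinner y y = 0" by (simp add: y_def cinner.diff_left)
  then show "S x = R x" by (simp add: cinner_self y_def)
qed

lemma sqrt_op:
  fixes A :: "'a::chilbert_space \<Rightarrow> 'a"
  assumes A: "A \<in> bounded_ops UNIV" and le: "\<And>x. norm (A x) \<le> norm x"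
    and sym: "\<And>x y. cinner (A x) y = cinner x (A y)"
  shows "positive_op (sqrt_op (\<lambda>x. x - A x))"
    and "sqrt_op (\<lambda>x. x - A x) (sqrt_op (\<lambda>x. x - A x) x) = x - A x"
proof -
  define B where "B = Blinfun A"
  have B: "blinfun_apply B = A"
    unfolding B_def by (rule bounded_linear_Blinfun_apply[OF bounded_linear_if_bounded_ops[OF A]])
  have "norm B \<le> 1" by (rule norm_blinfun_bound) (simp_all add: B le)
  note nB = root_iter_convergent[OF this] norm_root_iter_le[OF this]
  obtain Y where Y: "root_iter B \<longlonglongrightarrow> Y" using nB(1) convergentD by blast
  have Yx: "(\<lambda>n. root_iter B n x) \<longlonglongrightarrow> Y x" for x
    using blinfun.tendsto[OF Y tendsto_const] .
  have "(\<lambda>n. root_iter B (Suc n)) \<longlonglongrightarrow> (1/2) *\<^sub>R (B + (Y o\<^sub>L Y))"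
    unfolding root_iter.simps
    by (intro tendsto_intros Y bounded_bilinear.tendsto[OF bounded_bilinear_blinfun_compose])
  then have Y_eq: "Y = (1/2) *\<^sub>R (B + (Y o\<^sub>L Y))"
    using LIMSEQ_Suc[OF Y] LIMSEQ_unique by blast
  have YY: "2 *\<^sub>R Y x = A x + Y (Y x)" for x
  proof -
    have "2 *\<^sub>R Y = B + (Y o\<^sub>L Y)" by (subst Y_eq) simp
    then have "(2 *\<^sub>R Y) x = (B + (Y o\<^sub>L Y)) x" by simp
    then show ?thesis by (simp add: blinfun.bilinear_simps B)
  qed
  have Y_le: "norm (Y x) \<le> norm x" for x
  proof (rule LIMSEQ_le_const2[OF tendsto_norm[OF Yx]])
    have "norm (root_iter B n x) \<le> norm x" for n
    proof -
      have "norm (root_iter B n x) \<le> norm (root_iter B n) * norm x" by (rule norm_blinfun)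
      also have "\<dots> \<le> 1 * norm x"
        using nB(2)[of n] root_majorant_bounds[of n] by (intro mult_right_mono) auto
      finally show ?thesis by simp
    qed
    then show "\<exists>N. \<forall>n\<ge>N. norm (root_iter B n x) \<le> norm x" by blast
  qed
  have Y_sym: "cinner (Y x) y = cinner x (Y y)" for x y
  proof (rule LIMSEQ_unique)
    show "(\<lambda>n. cinner (root_iter B n x) y) \<longlonglongrightarrow> cinner (Y x) y"
      by (intro cinner.tendsto Yx tendsto_const)
    show "(\<lambda>n. cinner (root_iter B n x) y) \<longlonglongrightarrow> cinner x (Y y)"
      unfolding root_iter_symmetric[of B, unfolded B, OF sym]
      by (intro cinner.tendsto Yx tendsto_const)
  qed
  have Y_comm: "Y (C x) = C (Y x)" if "bounded_linear C" "\<And>x. A (C x) = C (A x)" for C x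
  proof (rule LIMSEQ_unique)
    show "(\<lambda>n. root_iter B n (C x)) \<longlonglongrightarrow> Y (C x)" by (rule Yx)
    show "(\<lambda>n. root_iter B n (C x)) \<longlonglongrightarrow> C (Y x)"
      unfolding root_iter_commute[of B C, unfolded B, OF that(2) bounded_linear.linear[OF that(1)]]
      by (intro bounded_linear.tendsto[OF that(1)] Yx)
  qed
  define S where "S x = x - Y x" for x
  have S_scaleC: "S (c *\<^sub>C x) = c *\<^sub>C S x" for c x
  proof -
    have "Y (c *\<^sub>C x) = c *\<^sub>C Y x"
      using complex_linear_onD(2)[OF bounded_opsD(3)[OF A]]
      by (intro Y_comm bounded_linear_scaleC) auto
    then show ?thesis
      unfolding S_def
      using linear_diff[OF bounded_linear.linear[OF bounded_linear_scaleC]] by metis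
  qed
  have "S \<in> bounded_ops UNIV"
  proof (rule bounded_opsI)
    show "complex_linear_on UNIV S"
      by (rule complex_linear_onI) (simp add: S_def blinfun.bilinear_simps, rule S_scaleC)
    fix x show "norm (S x) \<le> 2 * norm x"
      using norm_triangle_ineq4[of x "Y x"] Y_le[of x] by (simp add: S_def)
  qed
  moreover have "cinner (S x) x \<in> \<real>\<^sub>\<ge>\<^sub>0" for x
  proof -
    have "cmod (cinner (Y x) x) \<le> norm x * norm x"
      using cmod_cinner_le[of "Y x" x] Y_le[of x] by (meson mult_right_mono norm_ge_zero order_trans)
    then have "Re (cinner (Y x) x) \<le> (norm x)\<^sup>2"
      using complex_Re_le_cmod[of "cinner (Y x) x"] by (simp add: power2_eq_square)
    moreover have "Im (cinner (Y x) x) = 0"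
      using arg_cong[OF cinner_commute[of "Y x" x], of Im] Y_sym[of x x] by simp
    ultimately show ?thesis
      by (simp add: S_def cinner.diff_left cinner_self complex_nonneg_Reals_iff flip: of_real_power)
  qed
  ultimately have S_pos: "positive_op S" by (simp add: positive_op_def)
  have SS: "S (S x) = x - A x" for x
    using YY[of x] by (simp add: S_def blinfun.bilinear_simps scaleR_2 algebra_simps)
  have uniq: "R = S" if R: "positive_op R" and RR: "R \<circ> R = (\<lambda>x. x - A x)" for R
  proof -
    note blR = bounded_linear_if_bounded_ops[OF positive_opD(1)[OF R]]
    note diffR = linear_diff[OF bounded_linear.linear[OF blR]]
    have RR': "R (R x) = x - A x" for x using RR by (metis comp_apply)
    have "A (R x) = R (A x)" for x
    proof -
      have "R x - A (R x) = R (x - A x)" by (simp flip: RR')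
      then show ?thesis by (simp add: diffR)
    qed
    then have "Y (R x) = R (Y x)" for x using Y_comm[OF blR] by blast
    then have comm: "R (S x) = S (R x)" for x by (simp add: S_def diffR)
    show ?thesis by (rule positive_root_unique[OF R S_pos _ comm]) (simp only: RR' SS)
  qed
  have "sqrt_op (\<lambda>x. x - A x) = S"
    unfolding sqrt_op_def
  proof (rule the_equality)
    show "positive_op S \<and> S \<circ> S = (\<lambda>x. x - A x)" using S_pos SS by auto
  qed (use uniq in blast)
  then show "positive_op (sqrt_op (\<lambda>x. x - A x))"
    and "sqrt_op (\<lambda>x. x - A x) (sqrt_op (\<lambda>x. x - A x) x) = x - A x"
    using S_pos SS by simp_all
qed

text \<open>
  Unfolds the two descriptions behind the defect operator once and for all. The third claim is
  \<open>D\<^sup>2 = I - T\<^sup>* T\<close> in weak form, which avoids the adjoint of \<open>T\<close>.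
\<close>

lemma defect_op:
  assumes T: "T \<in> bounded_ops UNIV" and le: "\<And>x. norm (T x) \<le> norm x"
  shows "defect_op T \<in> bounded_ops UNIV"
    and "cinner (defect_op T x) y = cinner x (defect_op T y)"
    and "cinner (defect_op T x) (defect_op T y) = cinner x y - cinner (T x) (T y)"
proof -
  note adj = cinner_adj[OF T]
  let ?A = "\<lambda>x. adj T (T x)"
  have adj_le: "norm (adj T x) \<le> norm x" for x
  proof -
    have "(norm (adj T x))\<^sup>2 = Re (cinner (T (adj T x)) x)"
      using arg_cong[OF adj(1)[of "adj T x" x], of Re]
      by (simp only: cinner_self Re_complex_of_real)
    also have "\<dots> \<le> norm (T (adj T x)) * norm x"
      using cmod_cinner_le complex_Re_le_cmod order_trans by blast
    also have "\<dots> \<le> norm (adj T x) * norm x" by (intro mult_right_mono le) simp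
    finally show ?thesis by (cases "adj T x = 0") (auto simp: power2_eq_square)
  qed
  have A_le: "norm (?A x) \<le> norm x" for x using adj_le le order_trans by blast
  have A: "?A \<in> bounded_ops UNIV"
    using complex_linear_onD[OF bounded_opsD(3)[OF T]]
      complex_linear_onD[OF bounded_opsD(3)[OF adj_in_bounded_ops[OF T]]] A_le
    by (intro bounded_opsI[of _ 1] complex_linear_onI) auto
  have sym: "cinner (?A x) y = cinner x (?A y)" for x y by (simp add: adj)
  note D = sqrt_op[OF A A_le sym, folded defect_op_def]
  show "defect_op T \<in> bounded_ops UNIV" by (rule positive_opD(1)[OF D(1)])
  show symD: "cinner (defect_op T x) y = cinner x (defect_op T y)" for x y
    by (rule positive_op_symmetric[OF D(1)])
  show "cinner (defect_op T x) (defect_op T y) = cinner x y - cinner (T x) (T y)"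
    by (simp add: symD D(2) cinner.diff_right adj)
qed

section \<open>Factorisation through a self-adjoint operator\<close>

lemma limit_of_bounded_op:
  assumes X: "X \<in> bounded_ops M" and M: "complex_subspace M"
    and f: "\<And>n. f n \<in> M" "f \<longlonglongrightarrow> x" "x \<in> M"
  shows "(\<lambda>n. X (f n)) \<longlonglongrightarrow> X x"
proof -
  obtain K where K: "\<forall>x\<in>M. norm (X x) \<le> K * norm x" using bounded_opsD(4)[OF X] by blast
  have "norm (X (f n) - X x) \<le> K * norm (f n - x)" for n
  proof -
    have "X (f n + (- 1) *\<^sub>C x) = X (f n) + (- 1) *\<^sub>C X x"
      using complex_linear_onD(1,2)[OF bounded_opsD(3)[OF X]] complex_subspaceD(3)[OF M f(3)] f(1,3)
      by simp
    then have "X (f n) - X x = X (f n - x)" by (simp add: scaleC_minus_one)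
    moreover have "f n - x \<in> M" by (rule complex_subspaceD(5)[OF M f(1) f(3)])
    ultimately show ?thesis using K by metis
  qed
  then have "\<forall>\<^sub>F n in sequentially. norm (X (f n) - X x) \<le> K * norm (f n - x)"
    by (intro always_eventually allI)
  then have "(\<lambda>n. X (f n) - X x) \<longlonglongrightarrow> 0"
    by (rule Lim_null_comparison)
      (rule tendsto_mult_right_zero[OF tendsto_norm_zero[OF LIM_zero[OF f(2)]]])
  then show ?thesis by (rule LIM_zero_cancel)
qed

lemma complex_subspace_range:
  assumes "D \<in> bounded_ops UNIV"
  shows "complex_subspace (range D)"
  using complex_subspace_image[OF complex_subspace_UNIV bounded_opsD(3)[OF assms]] .

text \<open>
  The bilinear values on the range of \<open>D\<close> determine an operator on the closure of that range, by
  density on both sides. All uniqueness claims about operators on the defect space rest on this.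
\<close>

lemma bounded_ops_eqI:
  assumes D: "D \<in> bounded_ops UNIV"
    and F: "F \<in> bounded_ops (closure (range D))" and G: "G \<in> bounded_ops (closure (range D))"
    and eq: "\<And>h k. cinner (F (D h)) (D k) = cinner (G (D h)) (D k)"
  shows "F = G"
proof
  note R = complex_subspace_range[OF D]
  note M = complex_subspace_closure[OF R]
  have DM: "D h \<in> closure (range D)" for h by (rule subsetD[OF closure_subset rangeI])
  have eqD: "F (D h) = G (D h)" for h
    by (rule eq_in_closure_if_cinner_eq[OF R bounded_opsD(1)[OF F DM] bounded_opsD(1)[OF G DM]])
      (auto simp: eq)
  fix x
  show "F x = G x"
  proof (cases "x \<in> closure (range D)")
    case True
    then obtain f where f: "\<And>n::nat. f n \<in> range D" "f \<longlonglongrightarrow> x" by (auto simp: closure_sequential)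
    have fM: "f n \<in> closure (range D)" for n by (rule subsetD[OF closure_subset f(1)])
    have FG: "F (f n) = G (f n)" for n
    proof -
      obtain h where "f n = D h" using f(1)[of n] by (rule rangeE)
      then show ?thesis using eqD by simp
    qed
    show ?thesis
      using limit_of_bounded_op[OF F M fM f(2) True] limit_of_bounded_op[OF G M fM f(2) True]
      unfolding FG by (rule LIMSEQ_unique)
  next
    case False
    then show ?thesis using bounded_opsD(2)[OF F] bounded_opsD(2)[OF G] by simp
  qed
qed

text \<open>
  A form dominated by \<open>\<parallel>D x\<parallel> \<parallel>D y\<parallel>\<close> factors through \<open>D\<close> on both sides. The factors are split off one
  at a time by representing forms: \<open>\<langle>A x, b\<rangle> = \<langle>G x, D b\<rangle>\<close> with \<open>\<parallel>G x\<parallel> \<le> K \<parallel>D x\<parallel>\<close>, and then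
  \<open>\<langle>G x, m\<rangle> = \<langle>D x, V m\<rangle>\<close> for \<open>m\<close> in the closure of the range of \<open>D\<close>. The operator sought is the adjoint of \<open>V\<close>,
  so no operator has to be extended by continuity from a dense subspace.
\<close>

lemma sandwich_factorization:
  assumes D: "D \<in> bounded_ops UNIV" and sym: "\<And>x y. cinner (D x) y = cinner x (D y)"
    and A: "complex_linear_on UNIV A" and K: "K \<ge> 0"
    and bound: "\<And>x y. cmod (cinner (A x) y) \<le> K * norm (D x) * norm (D y)"
  shows "\<exists>F\<in>bounded_ops (closure (range D)). \<forall>h. A h = D (F (D h))"
proof -
  let ?M = "closure (range D)"
  note linD = bounded_opsD(3)[OF D]
  note M = complex_subspace_closure[OF complex_subspace_range[OF D]]
  have DM: "D h \<in> ?M" for h by (rule subsetD[OF closure_subset rangeI])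
  have "\<exists>G. (\<forall>x\<in>UNIV. G x \<in> ?M \<and> norm (G x) \<le> K * norm (D x)) \<and> complex_linear_on UNIV G \<and>
      (\<forall>b\<in>UNIV. \<forall>x\<in>UNIV. cinner (D b) (G x) = cinner b (A x))"
  proof (rule form_representation[OF complex_subspace_UNIV linD complex_subspace_UNIV])
    fix b x
    show "complex_linear_on UNIV (\<lambda>b. cinner b (A x))"
      by (intro complex_linear_onI) (simp_all add: cinner_add_left cinner_scaleC_left scaleC_complex_def)
    show "complex_linear_on UNIV (\<lambda>x. cnj (cinner b (A x)))"
      using complex_linear_onD[OF A]
      by (intro complex_linear_onI) (simp_all add: cinner_add_right cinner_scaleC_right scaleC_complex_def)
    show "cmod (cinner b (A x)) \<le> K * norm (D x) * norm (D b)"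
      using bound[of x b] by (subst cinner_commute) simp
  qed (simp add: K)
  then obtain G where G: "\<And>x. norm (G x) \<le> K * norm (D x)" "complex_linear_on UNIV G"
      "\<And>b x. cinner (D b) (G x) = cinner b (A x)" by auto
  have "\<exists>V. (\<forall>m\<in>?M. V m \<in> ?M \<and> norm (V m) \<le> K * norm m) \<and> complex_linear_on ?M V \<and>
      (\<forall>x\<in>UNIV. \<forall>m\<in>?M. cinner (D x) (V m) = cinner (G x) m)"
  proof (rule form_representation[OF complex_subspace_UNIV linD M])
    fix m x
    show "complex_linear_on UNIV (\<lambda>x. cinner (G x) m)"
      using complex_linear_onD[OF G(2)]
      by (intro complex_linear_onI) (simp_all add: cinner_add_left cinner_scaleC_left scaleC_complex_def)
    show "complex_linear_on ?M (\<lambda>m. cnj (cinner (G x) m))"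
      by (intro complex_linear_onI) (simp_all add: cinner_add_right cinner_scaleC_right scaleC_complex_def)
    have "cmod (cinner (G x) m) \<le> norm (G x) * norm m" by (rule cmod_cinner_le)
    also have "\<dots> \<le> K * norm (D x) * norm m" by (intro mult_right_mono G(1)) simp
    finally show "cmod (cinner (G x) m) \<le> K * norm m * norm (D x)" by (simp add: mult_ac)
  qed (simp add: K)
  then obtain V where V: "\<And>m. m \<in> ?M \<Longrightarrow> V m \<in> ?M" "\<And>m. m \<in> ?M \<Longrightarrow> norm (V m) \<le> K * norm m"
      "complex_linear_on ?M V" "\<And>x m. m \<in> ?M \<Longrightarrow> cinner (D x) (V m) = cinner (G x) m"
    by auto
  have VM: "restrict V ?M \<in> bounded_ops ?M" by (rule restrict_in_bounded_ops[OF M V(3,1,2)])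
  define F where "F = adj_on ?M (restrict V ?M)"
  note F = adj_on[OF M closed_closure VM, folded F_def]
  have "A h = D (F (D h))" for h
  proof (rule eq_if_cinner_eq)
    fix b
    have "cinner (D (F (D h))) b = cinner (F (D h)) (D b)" by (rule sym)
    also have "\<dots> = cnj (cinner (D b) (F (D h)))" by (rule cinner_commute)
    also have "\<dots> = cnj (cinner (V (D b)) (D h))" using F(2)[OF DM DM, of b h] DM by simp
    also have "\<dots> = cinner (D h) (V (D b))" by (rule cinner_commute[symmetric])
    also have "\<dots> = cinner (G h) (D b)" by (rule V(4)[OF DM])
    also have "\<dots> = cnj (cinner (D b) (G h))" by (rule cinner_commute)
    also have "\<dots> = cinner (A h) b" unfolding G(3) by (rule cinner_commute[symmetric])
    finally show "cinner (A h) b = cinner (D (F (D h))) b" by simp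
  qed
  then show ?thesis using F(1) by blast
qed

text \<open>
  The optimal weight is \<open>s = b / a\<close>; adding a small \<open>d\<close> to both numbers makes it available also when
  one of them is zero.
\<close>

lemma le_two_mult_if_le_weighted_squares:
  fixes a b c :: real
  assumes "a \<ge> 0" "b \<ge> 0" and le: "\<And>s. s > 0 \<Longrightarrow> s * c \<le> s\<^sup>2 * a\<^sup>2 + b\<^sup>2"
  shows "c \<le> 2 * a * b"
proof (rule field_le_epsilon)
  fix e :: real assume e: "e > 0"
  define d where "d = e / (a + b + 1)"
  have d: "d > 0" using e assms(1,2) by (simp add: d_def)
  define s where "s = (b + d) / (a + d)"
  have s: "s > 0" using d assms(1,2) by (simp add: s_def)
  have sa: "s * (a + d) = b + d" using d assms(1) by (simp add: s_def)
  have "s\<^sup>2 * a\<^sup>2 \<le> s * (s * (a + d)) * a"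
    using s d assms(1) by (simp add: power2_eq_square mult_left_mono mult_right_mono algebra_simps)
  also have "\<dots> = s * ((b + d) * a)" by (simp add: sa)
  finally have 1: "s\<^sup>2 * a\<^sup>2 \<le> s * ((b + d) * a)" .
  have "b\<^sup>2 \<le> (b + d) * b" using d assms(2) by (simp add: power2_eq_square algebra_simps)
  also have "\<dots> = s * ((a + d) * b)" by (simp flip: sa)
  finally have "s * c \<le> s * ((b + d) * a + (a + d) * b)"
    using le[OF s] 1 by (simp add: distrib_left)
  then have "c \<le> (b + d) * a + (a + d) * b" using s by simp
  also have "\<dots> = 2 * a * b + d * (a + b)" by (simp add: algebra_simps)
  also have "d * (a + b) \<le> d * (a + b + 1)" using d by simp
  also have "\<dots> = e" using assms(1,2) by (simp add: d_def)
  finally show "c \<le> 2 * a * b + e" by simp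
qed

text \<open>
  Polarisation together with the parallelogram law bounds \<open>|\<langle>A x, y\<rangle>|\<close> by \<open>\<parallel>D x\<parallel>\<^sup>2 + \<parallel>D y\<parallel>\<^sup>2\<close>. Replacing
  \<open>x\<close> by \<open>s x\<close> and optimising over \<open>s\<close> turns the sum of squares into a product.
\<close>

lemma form_bound_by_polarization:
  assumes A: "complex_linear_on UNIV A" and D: "complex_linear_on UNIV D"
    and q: "\<And>h. cmod (cinner (A h) h) \<le> (norm (D h))\<^sup>2"
  shows "cmod (cinner (A x) y) \<le> 2 * norm (D x) * norm (D y)"
proof -
  note linA = complex_linear_onD[OF A, simplified]
  note linD = complex_linear_onD[OF D, simplified]
  have sum: "cmod (cinner (A x) y) \<le> (norm (D x))\<^sup>2 + (norm (D y))\<^sup>2" for x y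
  proof -
    define Q where "Q c = cinner (A (x + c *\<^sub>C y)) (x + c *\<^sub>C y)" for c
    have "4 * cinner (A x) y = (Q 1 - Q (- 1)) + \<i> * (Q \<i> - Q (- \<i>))"
      by (simp add: Q_def linA cinner_add_left cinner_add_right cinner_scaleC_left
          cinner_scaleC_right algebra_simps)
    then have "4 * cmod (cinner (A x) y) = cmod ((Q 1 - Q (- 1)) + \<i> * (Q \<i> - Q (- \<i>)))"
      by (metis norm_mult norm_numeral)
    also have "\<dots> \<le> (cmod (Q 1) + cmod (Q (- 1))) + (cmod (Q \<i>) + cmod (Q (- \<i>)))"
      by (intro norm_triangle_mono norm_triangle_ineq4) (simp add: norm_mult norm_triangle_ineq4)
    also have "\<dots> \<le> (norm (D x + D y))\<^sup>2 + (norm (D x + (- 1) *\<^sub>C D y))\<^sup>2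
        + ((norm (D x + \<i> *\<^sub>C D y))\<^sup>2 + (norm (D x + (- \<i>) *\<^sub>C D y))\<^sup>2)"
      unfolding Q_def using q[of "x + 1 *\<^sub>C y"] q[of "x + (- 1) *\<^sub>C y"]
        q[of "x + \<i> *\<^sub>C y"] q[of "x + (- \<i>) *\<^sub>C y"]
      by (simp only: linD scaleC_one)
    also have "\<dots> = 4 * ((norm (D x))\<^sup>2 + (norm (D y))\<^sup>2)"
      by (simp add: norm_add_square norm_scaleC cinner_scaleC_right)
    finally show ?thesis by simp
  qed
  have "s * cmod (cinner (A x) y) \<le> s\<^sup>2 * (norm (D x))\<^sup>2 + (norm (D y))\<^sup>2" if "s > 0" for s
    using sum[of "s *\<^sub>R x" y] that by (simp add: linA linD cinner_scaleR_left power_mult_distrib)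
  then show ?thesis by (intro le_two_mult_if_le_weighted_squares) simp_all
qed

lemma cmod_le_if_rotations_le:
  assumes "\<And>z. cmod z = 1 \<Longrightarrow> Re (z * w) \<le> r"
  shows "cmod w \<le> r"
proof (cases "w = 0")
  case True then show ?thesis using assms[of 1] by simp
next
  case False
  have "Re ((cnj w / cmod w) * w) = Re (complex_of_real ((cmod w)\<^sup>2) / cmod w)"
    by (simp add: complex_norm_square mult.commute del: of_real_power)
  also have "\<dots> = cmod w" by (simp add: power2_eq_square)
  finally show ?thesis using assms[of "cnj w / cmod w"] False by (simp add: norm_divide)
qed

section \<open>Existence and characterisation of the fundamental operators\<close>

text \<open>
  This is used with \<open>a = T\<^sub>i h\<close>, \<open>b = T\<^sub>7\<^sub>-\<^sub>i h\<close> and \<open>p = T\<^sub>7 h\<close>; the left side is then the modulus of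
  \<open>\<langle>(T\<^sub>i - T\<^sub>7\<^sub>-\<^sub>i\<^sup>* T\<^sub>7) h, h\<rangle>\<close>. Squaring the first inequality bounds twice the real part
  of its rotations by \<open>\<parallel>h\<parallel>\<^sup>2 - \<parallel>p\<parallel>\<^sup>2 + \<parallel>a\<parallel>\<^sup>2 - \<parallel>b\<parallel>\<^sup>2\<close>, and the mean of the squared second inequality over
  \<open>z = 1, -1\<close> bounds \<open>\<parallel>a\<parallel>\<^sup>2 - \<parallel>b\<parallel>\<^sup>2\<close> by \<open>\<parallel>h\<parallel>\<^sup>2 - \<parallel>p\<parallel>\<^sup>2\<close>.
\<close>

lemma pencil_estimate:
  fixes h a b p :: "'a::chilbert_space"
  assumes 1: "\<And>z. cmod z = 1 \<Longrightarrow> norm (b - z *\<^sub>C p) \<le> norm (h - z *\<^sub>C a)"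
    and 2: "\<And>z. cmod z = 1 \<Longrightarrow> norm (a - z *\<^sub>C p) \<le> norm (h - z *\<^sub>C b)"
  shows "cmod (cinner a h - cinner p b) \<le> (norm h)\<^sup>2 - (norm p)\<^sup>2"
proof (rule cmod_le_if_rotations_le)
  have sq: "(norm y)\<^sup>2 + (norm p)\<^sup>2 - 2 * Re (cnj z * cinner y p)
      \<le> (norm h)\<^sup>2 + (norm x)\<^sup>2 - 2 * Re (cnj z * cinner h x)"
    if "cmod z = 1" "norm (y - z *\<^sub>C p) \<le> norm (h - z *\<^sub>C x)" for x y z
    using power_mono[OF that(2) norm_ge_zero, of 2] that(1)
    by (simp add: norm_diff_square norm_scaleC cinner_scaleC_right)
  have avg: "(norm a)\<^sup>2 + (norm p)\<^sup>2 \<le> (norm h)\<^sup>2 + (norm b)\<^sup>2"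
    using sq[OF _ 2, of 1] sq[OF _ 2, of "- 1"] by simp
  fix z :: complex assume z: "cmod z = 1"
  have "Re (cnj z * cinner h a) - Re (cnj z * cinner b p) = Re (z * (cinner a h - cinner p b))"
    unfolding cinner_commute[of h a] cinner_commute[of b p]
    by (simp add: algebra_simps)
  then show "Re (z * (cinner a h - cinner p b)) \<le> (norm h)\<^sup>2 - (norm p)\<^sup>2"
    using sq[OF z 1[OF z]] avg by argo
qed

lemma index_reflection:
  fixes i :: 7
  assumes "i \<in> {1..6}"
  shows "7 - i \<in> {1..6}" and "7 - (7 - i) = i"
proof -
  have "i \<in> {1,2,3,4,5,6}" using assms index_seven(1) by simp
  then show "7 - i \<in> {1..6}" unfolding index_seven(1) by (auto simp: index_seven)
qed simp

text \<open>
  Since \<open>\<parallel>D T\<^sup>n h\<parallel>\<^sup>2 = \<parallel>T\<^sup>n h\<parallel>\<^sup>2 - \<parallel>T\<^sup>n\<^sup>+\<^sup>1 h\<parallel>\<^sup>2\<close> is a difference of consecutive terms of a decreasing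
  sequence, it tends to zero, and the form can be evaluated arbitrarily far along the orbits.
\<close>

lemma invariant_form_zero:
  assumes T: "T \<in> bounded_ops UNIV" and le: "\<And>x. norm (T x) \<le> norm x"
    and bound: "\<And>h k. cmod (B h k) \<le> K * norm (defect_op T h) * norm (defect_op T k)"
    and inv: "\<And>h k. B h k = B (T h) (T k)"
  shows "B h k = 0"
proof -
  let ?D = "defect_op T"
  have D0: "(\<lambda>n. norm (?D ((T ^^ n) h))) \<longlonglongrightarrow> 0" for h
  proof -
    have eq: "(norm (?D x))\<^sup>2 = (norm x)\<^sup>2 - (norm (T x))\<^sup>2" for x
    proof -
      have "complex_of_real ((norm (?D x))\<^sup>2) = complex_of_real ((norm x)\<^sup>2 - (norm (T x))\<^sup>2)"
        using defect_op(3)[OF T le, of x x] by (simp only: cinner_self of_real_diff)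
      then show ?thesis using of_real_eq_iff by blast
    qed
    have "decseq (\<lambda>n. (norm ((T ^^ n) h))\<^sup>2)"
      by (intro decseq_SucI power_mono) (simp_all add: le)
    then have "convergent (\<lambda>n. (norm ((T ^^ n) h))\<^sup>2)"
      by (rule decseq_convergent[where B = 0]) (auto intro: convergentI)
    then obtain l where l: "(\<lambda>n. (norm ((T ^^ n) h))\<^sup>2) \<longlonglongrightarrow> l" using convergentD by blast
    have "(\<lambda>n. (norm ((T ^^ n) h))\<^sup>2 - (norm ((T ^^ Suc n) h))\<^sup>2) \<longlonglongrightarrow> l - l"
      by (intro tendsto_diff l LIMSEQ_Suc[OF l])
    then have "(\<lambda>n. (norm (?D ((T ^^ n) h)))\<^sup>2) \<longlonglongrightarrow> 0" by (simp add: eq)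
    then have "(\<lambda>n. sqrt ((norm (?D ((T ^^ n) h)))\<^sup>2)) \<longlonglongrightarrow> sqrt 0" by (rule tendsto_real_sqrt)
    then show ?thesis by simp
  qed
  have B_pow: "B h k = B ((T ^^ n) h) ((T ^^ n) k)" for n
    by (induction n) (use inv in auto)
  have "(\<lambda>n. K * norm (?D ((T ^^ n) h)) * norm (?D ((T ^^ n) k))) \<longlonglongrightarrow> K * 0 * 0"
    by (intro tendsto_intros D0)
  then have "cmod (B h k) \<le> K * 0 * 0"
    by (rule LIMSEQ_le_const) (use B_pow bound in metis)
  then show ?thesis by simp
qed

text \<open>
  Write \<open>P = T\<^sub>7\<close> and \<open>A\<^sub>i = T\<^sub>i - T\<^sub>7\<^sub>-\<^sub>i\<^sup>* P\<close>. The pencil inequalities give \<open>|\<langle>A\<^sub>i h, h\<rangle>| \<le> \<parallel>D h\<parallel>\<^sup>2\<close>, so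
  \<open>A\<^sub>i = D F\<^sub>i D\<close>. The two operator equations are read weakly against vectors \<open>D k\<close>. For \<open>F\<close> they follow
  from \<open>D\<^sup>2 = I - P\<^sup>* P\<close> and commutativity. If \<open>X\<close> satisfies them as well, then the forms
  \<open>B\<^sub>i(h, k) = \<langle>(X\<^sub>i - F\<^sub>i) D h, D k\<rangle>\<close> are related by \<open>B\<^sub>i(h, k) = - cnj B\<^sub>7\<^sub>-\<^sub>i(k, P h)\<close>. Applying this twice
  gives \<open>B\<^sub>i(h, k) = B\<^sub>i(P h, P k)\<close>, which forces \<open>B\<^sub>i = 0\<close>.
\<close>

lemma fundamental_operators_characterization:
  fixes T :: "7 \<Rightarrow> 'a::chilbert_space \<Rightarrow> 'a"
  assumes comm: "commuting_tuple T"
    and pencil: "\<And>i z h. i \<in> {1..6} \<Longrightarrow> cmod z = 1 \<Longrightarrow>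
      norm (T i h - z *\<^sub>C T 7 h) \<le> norm (h - z *\<^sub>C T (7 - i) h)"
  shows "\<exists>F. fundamental_operators T F \<and>
    (\<forall>X \<in> op_tuples (defect_space (T 7)).
      (\<forall>i\<in>{1..6}. \<forall>h.
         defect_op (T 7) (T i h) =
           X i (defect_op (T 7) h) +
           adj_on (defect_space (T 7)) (X (7 - i)) (defect_op (T 7) (T 7 h)) \<and>
         defect_op (T 7) (T (7 - i) h) =
           X (7 - i) (defect_op (T 7) h) +
           adj_on (defect_space (T 7)) (X i) (defect_op (T 7) (T 7 h)))
      \<longleftrightarrow> X = F)"
proof -
  let ?D = "defect_op (T 7)" and ?M = "defect_space (T 7)"
  define A where "A i h = T i h - adj (T (7 - i)) (T 7 h)" for i h
  have T: "T i \<in> bounded_ops UNIV" for i using comm by (simp add: commuting_tuple_def)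
  have TT: "T i (T 7 h) = T 7 (T i h)" for i h
    using comm unfolding commuting_tuple_def by (metis comp_apply)
  note linT = complex_linear_onD[OF bounded_opsD(3)[OF T], simplified]
  note adjT = cinner_adj[OF T]
  have estimate: "cmod (cinner (T i h) h - cinner (T 7 h) (T (7 - i) h)) \<le> (norm h)\<^sup>2 - (norm (T 7 h))\<^sup>2"
    if i: "i \<in> {1..6}" for i h
    using pencil[OF i] pencil[OF index_reflection(1)[OF i]]
    by (intro pencil_estimate) (simp_all add: index_reflection(2)[OF i])
  have le: "norm (T 7 h) \<le> norm h" for h
  proof (rule power2_le_imp_le)
    have "(1 :: 7) \<in> {1..6}" unfolding index_seven(1) by simp
    from order_trans[OF norm_ge_zero estimate[OF this, of h]]
    show "(norm (T 7 h))\<^sup>2 \<le> (norm h)\<^sup>2" by simp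
  qed simp
  note D = defect_op[OF T le]
  have M: "complex_subspace ?M" "closed ?M"
    unfolding defect_space_def
    using complex_subspace_closure[OF complex_subspace_range[OF D(1)]] by auto
  have DM: "?D h \<in> ?M" for h unfolding defect_space_def by (rule subsetD[OF closure_subset rangeI])
  have normD: "(norm (?D h))\<^sup>2 = (norm h)\<^sup>2 - (norm (T 7 h))\<^sup>2" for h
  proof -
    have "complex_of_real ((norm (?D h))\<^sup>2) = complex_of_real ((norm h)\<^sup>2 - (norm (T 7 h))\<^sup>2)"
      using D(3)[of h h] by (simp only: cinner_self of_real_diff)
    then show ?thesis using of_real_eq_iff by blast
  qed
  have A_inner: "cinner (A i h) k = cinner (T i h) k - cinner (T 7 h) (T (7 - i) k)" for i h k
    by (simp add: A_def cinner.diff_left adjT)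
  have linA: "complex_linear_on UNIV (A i)" for i
    using complex_linear_onD[OF bounded_opsD(3)[OF adj_in_bounded_ops[OF T]]]
    by (intro complex_linear_onI)
      (simp_all add: A_def linT linear_diff[OF bounded_linear.linear[OF bounded_linear_scaleC]])
  have "\<exists>F\<in>bounded_ops ?M. \<forall>h. A i h = ?D (F (?D h))" if i: "i \<in> {1..6}" for i
    unfolding defect_space_def
  proof (rule sandwich_factorization[OF D(1,2) linA])
    show "cmod (cinner (A i x) y) \<le> 2 * norm (?D x) * norm (?D y)" for x y
      using estimate[OF i]
      by (intro form_bound_by_polarization[OF linA bounded_opsD(3)[OF D(1)]])
        (simp add: A_inner normD)
  qed simp
  then obtain F' where F': "\<And>i. i \<in> {1..6} \<Longrightarrow> F' i \<in> bounded_ops ?M"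
      "\<And>i h. i \<in> {1..6} \<Longrightarrow> A i h = ?D (F' i (?D h))" by metis
  define F where "F = restrict F' {1..6}"
  have F: "F i \<in> bounded_ops ?M" "A i h = ?D (F i (?D h))" if "i \<in> {1..6}" for i h
    using F' that by (auto simp: F_def)
  have F_tuple: "F \<in> op_tuples ?M" using F' by (auto simp: op_tuples_def F_def)
  have F_inner: "cinner (F i (?D h)) (?D k) = cinner (A i h) k" if "i \<in> {1..6}" for i h k
    by (simp add: F(2)[OF that] D(2))
  have tuple_eqI: "X = Y"
    if X: "X \<in> op_tuples ?M" and Y: "Y \<in> op_tuples ?M"
      and eq: "\<And>i h k. i \<in> {1..6} \<Longrightarrow> cinner (X i (?D h)) (?D k) = cinner (Y i (?D h)) (?D k)" for X Y
    using X[unfolded op_tuples_def] Y[unfolded op_tuples_def]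
  proof (rule PiE_ext)
    fix i :: 7 assume i: "i \<in> {1..6}"
    then have "X i \<in> bounded_ops ?M" "Y i \<in> bounded_ops ?M"
      using X Y by (auto simp: op_tuples_def)
    then show "X i = Y i"
      unfolding defect_space_def by (rule bounded_ops_eqI[OF D(1)]) (rule eq[OF i])
  qed
  have "fundamental_operators T F"
    unfolding fundamental_operators_def
  proof (intro conjI ballI impI)
    show "F \<in> op_tuples ?M" by (rule F_tuple)
    show "fundamental_equations T F"
      using F(2) by (simp add: fundamental_equations_def A_def)
    fix G assume G: "G \<in> op_tuples ?M" "fundamental_equations T G"
    have "cinner (G i (?D h)) (?D k) = cinner (A i h) k" if "i \<in> {1..6}" for i h k
      using G(2) that by (simp add: fundamental_equations_def A_def D(2))
    then show "G = F" by (intro tuple_eqI[OF G(1) F_tuple]) (simp add: F_inner)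
  qed
  moreover have "(\<forall>i\<in>{1..6}. \<forall>h.
      ?D (T i h) = X i (?D h) + adj_on ?M (X (7 - i)) (?D (T 7 h)) \<and>
      ?D (T (7 - i) h) = X (7 - i) (?D h) + adj_on ?M (X i) (?D (T 7 h))) \<longleftrightarrow> X = F"
    (is "?E X \<longleftrightarrow> _") if X: "X \<in> op_tuples ?M" for X
  proof -
    \<comment> \<open>Both sides lie in the defect space, so it suffices to test against the range of \<open>D\<close>.\<close>
    have weak: "(?D (T i h) = Y i (?D h) + adj_on ?M (Y (7 - i)) (?D (T 7 h))) \<longleftrightarrow>
        (\<forall>k. cinner (?D (T i h)) (?D k)
          = cinner (Y i (?D h)) (?D k) + cnj (cinner (Y (7 - i) (?D k)) (?D (T 7 h))))"
      if Y: "Y \<in> op_tuples ?M" and i: "i \<in> {1..6}" for Y i h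
    proof -
      have Yi: "Y i \<in> bounded_ops ?M" and Yj: "Y (7 - i) \<in> bounded_ops ?M"
        using Y i index_reflection(1)[OF i] by (auto simp: op_tuples_def)
      note adjY = adj_on[OF M Yj]
      have conv: "cinner (adj_on ?M (Y (7 - i)) (?D (T 7 h))) (?D k)
          = cnj (cinner (Y (7 - i) (?D k)) (?D (T 7 h)))" for k
        unfolding adjY(2)[OF DM DM] by (rule cinner_commute)
      show ?thesis
      proof
        assume "?D (T i h) = Y i (?D h) + adj_on ?M (Y (7 - i)) (?D (T 7 h))"
        then show "\<forall>k. cinner (?D (T i h)) (?D k)
          = cinner (Y i (?D h)) (?D k) + cnj (cinner (Y (7 - i) (?D k)) (?D (T 7 h)))"
          by (simp only: cinner_add_left conv) simp
      next
        assume *: "\<forall>k. cinner (?D (T i h)) (?D k)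
          = cinner (Y i (?D h)) (?D k) + cnj (cinner (Y (7 - i) (?D k)) (?D (T 7 h)))"
        show "?D (T i h) = Y i (?D h) + adj_on ?M (Y (7 - i)) (?D (T 7 h))"
        proof (rule eq_in_closure_if_cinner_eq[OF complex_subspace_range[OF D(1)]])
          show "?D (T i h) \<in> closure (range ?D)" "Y i (?D h) + adj_on ?M (Y (7 - i)) (?D (T 7 h)) \<in> closure (range ?D)"
            unfolding defect_space_def[symmetric]
            using DM bounded_opsD(1)[OF Yi] bounded_opsD(1)[OF adjY(1)] complex_subspaceD(2)[OF M(1)]
            by auto
        qed (use * in \<open>auto simp: cinner_add_left conv\<close>)
      qed
    qed
    have F_weak: "cinner (?D (T i h)) (?D k)
        = cinner (F i (?D h)) (?D k) + cnj (cinner (F (7 - i) (?D k)) (?D (T 7 h)))"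
      if i: "i \<in> {1..6}" for i h k
    proof -
      have "cnj (cinner (A (7 - i) k) (T 7 h)) = cinner (T 7 h) (A (7 - i) k)"
        by (rule cinner_commute[symmetric])
      also have "\<dots> = cinner (T 7 h) (T (7 - i) k) - cinner (T i (T 7 h)) (T 7 k)"
        unfolding A_def cinner.diff_right index_reflection(2)[OF i] adjT ..
      finally show ?thesis
        unfolding D(3) F_inner[OF i] F_inner[OF index_reflection(1)[OF i]] A_inner TT by simp
    qed
    show ?thesis
    proof
      assume "X = F"
      show "?E X"
        unfolding \<open>X = F\<close>
      proof (intro ballI allI conjI)
        fix i :: 7 and h assume i: "i \<in> {1..6}"
        show "?D (T i h) = F i (?D h) + adj_on ?M (F (7 - i)) (?D (T 7 h))"
          using weak[OF F_tuple i] F_weak[OF i] by blast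
        show "?D (T (7 - i) h) = F (7 - i) (?D h) + adj_on ?M (F i) (?D (T 7 h))"
          using weak[OF F_tuple index_reflection(1)[OF i]] F_weak[OF index_reflection(1)[OF i]]
          unfolding index_reflection(2)[OF i] by blast
      qed
    next
      assume E: "?E X"
      define B where "B i h k = cinner (X i (?D h)) (?D k) - cinner (F i (?D h)) (?D k)" for i h k
      have B_swap: "B i h k = - cnj (B (7 - i) k (T 7 h))" if i: "i \<in> {1..6}" for i h k
      proof -
        have "cinner (?D (T i h)) (?D k)
            = cinner (X i (?D h)) (?D k) + cnj (cinner (X (7 - i) (?D k)) (?D (T 7 h)))"
          using weak[OF X i, of h] E i by blast
        then show ?thesis using F_weak[OF i, of h k] by (simp add: B_def algebra_simps)
      qed
      have B_inv: "B i h k = B i (T 7 h) (T 7 k)" if i: "i \<in> {1..6}" for i h k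
        using B_swap[OF i, of h k] B_swap[OF index_reflection(1)[OF i], of k "T 7 h"]
        by (simp add: index_reflection(2)[OF i])
      have "B i h k = 0" if i: "i \<in> {1..6}" for i h k
      proof -
        have Xi: "X i \<in> bounded_ops ?M" using X i by (auto simp: op_tuples_def)
        obtain K L where K: "\<And>x. x \<in> ?M \<Longrightarrow> norm (X i x) \<le> K * norm x"
          and L: "\<And>x. x \<in> ?M \<Longrightarrow> norm (F i x) \<le> L * norm x"
          using bounded_opsD(4)[OF Xi] bounded_opsD(4)[OF F(1)[OF i]] by blast
        have "cmod (B i h k) \<le> (K + L) * norm (?D h) * norm (?D k)" for h k
        proof -
          have "cmod (B i h k) \<le> cmod (cinner (X i (?D h)) (?D k)) + cmod (cinner (F i (?D h)) (?D k))"
            unfolding B_def by (rule norm_triangle_ineq4)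
          also have "\<dots> \<le> norm (X i (?D h)) * norm (?D k) + norm (F i (?D h)) * norm (?D k)"
            by (intro add_mono cmod_cinner_le)
          also have "\<dots> \<le> K * norm (?D h) * norm (?D k) + L * norm (?D h) * norm (?D k)"
            by (intro add_mono mult_right_mono K L DM) simp_all
          finally show ?thesis by (simp add: algebra_simps)
        qed
        then show ?thesis by (rule invariant_form_zero[where B = "B i" and T = "T 7", OF T le _ B_inv[OF i]])
      qed
      then show "X = F" by (intro tuple_eqI[OF X F_tuple]) (simp add: B_def)
    qed
  qed
  ultimately show ?thesis by blast
qed

section \<open>The scalar pencil inequality on the domain\<close>

lemma norm_diag_mult_le:
  fixes z :: "3 \<Rightarrow> complex" and v :: "complex ^ 3"
  assumes "\<And>i. cmod (z i) \<le> r" "r \<ge> 0"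
  shows "norm ((\<chi> i j. if i = j then z i else 0) *v v) \<le> r * norm v"
proof -
  have "((\<chi> i j. if i = j then z i else 0) *v v) $ i = z i * v $ i" for i
    by (simp add: matrix_vector_mult_def if_distrib[of "\<lambda>x. x * _"] cong: if_cong)
  then have "norm ((\<chi> i j. if i = j then z i else 0) *v v) = L2_set (\<lambda>i. norm (z i * v $ i)) UNIV"
    by (simp add: norm_vec_def)
  also have "\<dots> \<le> L2_set (\<lambda>i. r * norm (v $ i)) UNIV"
    by (intro L2_set_mono) (simp_all add: norm_mult assms mult_right_mono)
  also have "\<dots> = r * norm v" by (simp add: norm_vec_def L2_set_right_distrib assms(2))
  finally show ?thesis .
qed

lemma mu_witness_norm_ge:
  assumes "X \<in> mu_witnesses A"
  shows "1 \<le> onorm (\<lambda>v. A *v v) * onorm (\<lambda>v. X *v v)"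
proof -
  have "det (mat 1 - A ** X) = 0" using assms by (simp add: mu_witnesses_def)
  then have "\<not> invertible (mat 1 - A ** X)" by (simp add: invertible_det_nz)
  then obtain v where "(mat 1 - A ** X) *v v = 0" and v: "v \<noteq> 0"
    unfolding invertible_left_inverse matrix_left_invertible_ker by blast
  then have "v = A *v (X *v v)"
    by (simp add: matrix_vector_mult_diff_rdistrib matrix_vector_mul_assoc)
  then have "norm v \<le> onorm (\<lambda>v. A *v v) * norm (X *v v)"
    by (metis onorm matrix_vector_mul_bounded_linear)
  also have "\<dots> \<le> onorm (\<lambda>v. A *v v) * (onorm (\<lambda>v. X *v v) * norm v)"
    by (intro mult_left_mono onorm onorm_pos_le matrix_vector_mul_bounded_linear)
  finally show ?thesis using v by simp
qed

text \<open>
  Division by zero makes \<open>mu A = 0\<close> if the infimum of the norms of the witnesses is zero. This does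
  not happen: by the previous lemma the infimum is at least \<open>1 / \<parallel>A\<parallel>\<close>. Hence \<open>mu A \<le> 1\<close> means that no
  diagonal matrix of norm less than one is a witness.
\<close>

lemma det_nonzero_if_mu_le_one:
  fixes z :: "3 \<Rightarrow> complex"
  assumes mu: "mu A \<le> 1" and z: "\<And>i. cmod (z i) < 1"
  shows "det (mat 1 - A ** (\<chi> i j. if i = j then z i else 0)) \<noteq> 0"
proof
  let ?X = "\<chi> i j. if i = j then z i else 0"
  let ?N = "\<lambda>X :: complex ^ 3 ^ 3. onorm (\<lambda>v. X *v v)"
  assume "det (mat 1 - A ** ?X) = 0"
  then have X: "?X \<in> mu_witnesses A" by (simp add: mu_witnesses_def)
  define r where "r = Max (range (\<lambda>i. cmod (z i)))"
  have z_le: "cmod (z i) \<le> r" for i by (simp add: r_def)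
  have r: "0 \<le> r" "r < 1" using order_trans[OF norm_ge_zero z_le] z by (auto simp: r_def)
  have "?N ?X \<le> r" by (rule onorm_bound) (use r norm_diag_mult_le[OF z_le] in auto)
  then have X_lt: "?N ?X < 1" using r by simp
  have A_pos: "?N A > 0"
  proof (rule ccontr)
    assume "\<not> ?N A > 0"
    then have "?N A = 0" using onorm_pos_le[OF matrix_vector_mul_bounded_linear[of A]] by simp
    then show False using mu_witness_norm_ge[OF X] by simp
  qed
  have ge: "1 / ?N A \<le> ?N Y" if "Y \<in> mu_witnesses A" for Y
    using mu_witness_norm_ge[OF that] A_pos by (simp add: field_simps)
  define I where "I = (INF Y\<in>mu_witnesses A. ?N Y)"
  have "0 < 1 / ?N A" using A_pos by simp
  also have "1 / ?N A \<le> I" unfolding I_def using X ge by (intro cINF_greatest) auto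
  finally have "I > 0" .
  moreover have "1 / I \<le> 1"
  proof -
    have "mu_witnesses A \<noteq> {}" using X by blast
    then show ?thesis using mu by (simp add: mu_def I_def)
  qed
  ultimately have "I \<ge> 1" by (simp add: field_simps)
  moreover have "I \<le> ?N ?X"
    unfolding I_def
  proof (rule cInf_lower)
    show "?N ?X \<in> ?N ` mu_witnesses A" by (rule imageI[OF X])
    show "bdd_below (?N ` mu_witnesses A)" by (rule bdd_belowI2) (rule ge)
  qed
  ultimately show False using X_lt by simp
qed

text \<open>
  The product of the two roots is \<open>c / a\<close>, and neither lies in the open unit disc.
\<close>

lemma quadratic_leading_le_constant:
  fixes a b c :: complex
  assumes "\<And>w. cmod w < 1 \<Longrightarrow> c + b * w + a * w\<^sup>2 \<noteq> 0"
  shows "cmod a \<le> cmod c"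
proof (cases "a = 0")
  case False
  define s where "s = csqrt (b\<^sup>2 - 4 * a * c)"
  have s: "s\<^sup>2 = b\<^sup>2 - 4 * a * c" by (simp add: s_def)
  define p q where "p = (- b + s) / (2 * a)" and "q = (- b - s) / (2 * a)"
  have sum: "a * (p + q) = - b" using False by (simp add: p_def q_def field_simps)
  have prod: "a * (p * q) = c"
  proof -
    have "a * (p * q) = (b\<^sup>2 - s\<^sup>2) / (4 * a)"
      using False by (simp add: p_def q_def power2_eq_square field_simps)
    also have "\<dots> = c" using False by (simp add: s)
    finally show ?thesis .
  qed
  have fac: "c + b * w + a * w\<^sup>2 = a * (w - p) * (w - q)" for w
  proof -
    have "b = - (a * (p + q))" by (simp add: sum)
    then have "c + b * w + a * w\<^sup>2 = a * (p * q) + - (a * (p + q)) * w + a * w\<^sup>2"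
      by (simp only: prod)
    then show ?thesis by (simp add: power2_eq_square algebra_simps)
  qed
  have "1 \<le> cmod p" "1 \<le> cmod q" using assms[of p] assms[of q] fac by (force simp: not_less)+
  then have "1 \<le> cmod (p * q)"
    using mult_mono[of 1 "cmod p" 1 "cmod q"] by (simp add: norm_mult)
  then have "cmod a * 1 \<le> cmod a * cmod (p * q)" by (intro mult_left_mono) auto
  then show ?thesis by (simp add: prod flip: norm_mult)
qed simp

lemma linear_coeff_le_constant:
  fixes u v :: complex
  assumes "\<And>z. cmod z < 1 \<Longrightarrow> u - z * v \<noteq> 0"
  shows "cmod v \<le> cmod u"
proof (rule ccontr)
  assume "\<not> cmod v \<le> cmod u"
  then have "v \<noteq> 0" "cmod (u / v) < 1" by (auto simp: norm_divide divide_less_eq)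
  then show False using assms[of "u / v"] by simp
qed

text \<open>
  Both inequalities express that \<open>1 - z a - w m + z w d\<close> has no zero in the open bidisc, a condition
  symmetric under exchanging \<open>(z, a)\<close> with \<open>(w, m)\<close>. It says that \<open>(a, m, d)\<close> lies in the closed
  tetrablock.
\<close>

lemma disc_pencil_swap:
  fixes a m d :: complex
  assumes nz: "\<And>z. cmod z < 1 \<Longrightarrow> 1 - z * a \<noteq> 0"
    and le: "\<And>z. cmod z < 1 \<Longrightarrow> cmod (m - z * d) \<le> cmod (1 - z * a)"
    and w: "cmod w < 1"
  shows "1 - w * m \<noteq> 0" and "cmod (a - w * d) \<le> cmod (1 - w * m)"
proof -
  have *: "(1 - w * m) - z * (a - w * d) \<noteq> 0" if z: "cmod z < 1" for z
  proof
    assume "(1 - w * m) - z * (a - w * d) = 0"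
    then have "1 - z * a = w * (m - z * d)" by (simp add: algebra_simps)
    then have "cmod (1 - z * a) = cmod w * cmod (m - z * d)" by (metis norm_mult)
    also have "\<dots> \<le> cmod w * cmod (1 - z * a)" by (intro mult_left_mono le z) simp
    finally have "(1 - cmod w) * cmod (1 - z * a) \<le> 0" by (simp add: algebra_simps)
    moreover have "(1 - cmod w) * cmod (1 - z * a) > 0" using w nz[OF z] by simp
    ultimately show False by simp
  qed
  show "1 - w * m \<noteq> 0" using *[of 0] by simp
  show "cmod (a - w * d) \<le> cmod (1 - w * m)" by (rule linear_coeff_le_constant) (rule *)
qed

lemma det_diag_pencil:
  fixes A :: "complex ^ 3 ^ 3"
  shows "det (mat 1 - A ** (\<chi> i j. if i = j then z i else 0)) =
    1 - z 1 * A $ 1 $ 1 - z 2 * A $ 2 $ 2 - z 3 * A $ 3 $ 3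
    + z 1 * z 2 * (A $ 1 $ 1 * A $ 2 $ 2 - A $ 1 $ 2 * A $ 2 $ 1)
    + z 1 * z 3 * (A $ 1 $ 1 * A $ 3 $ 3 - A $ 1 $ 3 * A $ 3 $ 1)
    + z 2 * z 3 * (A $ 2 $ 2 * A $ 3 $ 3 - A $ 2 $ 3 * A $ 3 $ 2)
    - z 1 * z 2 * z 3 * det A"
proof -
  have entry: "(mat 1 - A ** (\<chi> i j. if i = j then z i else 0)) $ i $ j
      = (if i = j then 1 else 0) - A $ i $ j * z j" for i j
    by (simp add: matrix_matrix_mult_def mat_def if_distrib[of "\<lambda>x. _ * x"] cong: if_cong)
  show ?thesis unfolding det_3 entry by (simp add: algebra_simps)
qed

lemma diag_minor_pencil:
  fixes a b m d :: complex
  assumes "\<And>w. cmod w < 1 \<Longrightarrow> (1 - z * a) + b * w + (m - z * d) * w\<^sup>2 \<noteq> 0"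
  shows "1 - z * a \<noteq> 0 \<and> cmod (m - z * d) \<le> cmod (1 - z * a)"
  using quadratic_leading_le_constant[OF assms] assms[of 0] by simp

text \<open>
  For the diagonal entries, put \<open>z\<close> at one place of the diagonal of \<open>X\<close> and \<open>w\<close> at the other two. As a
  polynomial in \<open>w\<close>, the nonvanishing determinant of \<open>I - A X\<close> has constant term \<open>1 - z x\<^sub>p\<close> and leading
  coefficient \<open>x\<^sub>7\<^sub>-\<^sub>p - z x\<^sub>7\<close>. This handles one index of each pair \<open>{p, 7 - p}\<close>; the other one follows by
  \<open>disc_pencil_swap\<close>.
\<close>

lemma Gamma_E_pencil:
  assumes x: "x \<in> Gamma_E" and i: "i \<in> {1..6}" and z: "cmod z < 1"
  shows "1 - z * x $ (7 - i) \<noteq> 0 \<and> cmod (x $ i - z * x $ 7) \<le> cmod (1 - z * x $ (7 - i))"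
proof -
  obtain A :: "complex ^ 3 ^ 3" where mu: "mu A \<le> 1" and
     xA: "x $ 1 = A $ 1 $ 1" "x $ 2 = A $ 2 $ 2" "x $ 4 = A $ 3 $ 3"
     "x $ 6 = A $ 2 $ 2 * A $ 3 $ 3 - A $ 2 $ 3 * A $ 3 $ 2"
     "x $ 5 = A $ 1 $ 1 * A $ 3 $ 3 - A $ 1 $ 3 * A $ 3 $ 1"
     "x $ 3 = A $ 1 $ 1 * A $ 2 $ 2 - A $ 1 $ 2 * A $ 2 $ 1"
     "x $ 7 = det A"
    using x unfolding Gamma_E_def by blast
  have nz: "1 - z 1 * x $ 1 - z 2 * x $ 2 - z 3 * x $ 4 + z 1 * z 2 * x $ 3 + z 1 * z 3 * x $ 5
      + z 2 * z 3 * x $ 6 - z 1 * z 2 * z 3 * x $ 7 \<noteq> 0"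
    if "\<And>i. cmod (z i) < 1" for z :: "3 \<Rightarrow> complex"
    using det_nonzero_if_mu_le_one[OF mu that] unfolding det_diag_pencil xA .
  have diag: "1 - z * x $ p \<noteq> 0 \<and> cmod (x $ (7 - p) - z * x $ 7) \<le> cmod (1 - z * x $ p)"
    if p: "p \<in> {1, 2, 4}" and z: "cmod z < 1" for p z
  proof -
    have 1: "(1 - z * x $ 1) + (z * x $ 3 + z * x $ 5 - x $ 2 - x $ 4) * w
        + (x $ 6 - z * x $ 7) * w\<^sup>2 \<noteq> 0" if "cmod w < 1" for w
      using nz[of "\<lambda>i. if i = 1 then z else w"] z that
      by (simp add: power2_eq_square algebra_simps)
    have 2: "(1 - z * x $ 2) + (z * x $ 3 + z * x $ 6 - x $ 1 - x $ 4) * w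
        + (x $ 5 - z * x $ 7) * w\<^sup>2 \<noteq> 0" if "cmod w < 1" for w
      using nz[of "\<lambda>i. if i = 2 then z else w"] z that
      by (simp add: power2_eq_square algebra_simps)
    have 3: "(1 - z * x $ 4) + (z * x $ 5 + z * x $ 6 - x $ 1 - x $ 2) * w
        + (x $ 3 - z * x $ 7) * w\<^sup>2 \<noteq> 0" if "cmod w < 1" for w
      using nz[of "\<lambda>i. if i = 3 then z else w"] z that
      by (simp add: power2_eq_square algebra_simps)
    show ?thesis
      using p diag_minor_pencil[OF 1] diag_minor_pencil[OF 2] diag_minor_pencil[OF 3]
      by (elim insertE) (simp_all add: index_seven)
  qed
  have minor: "1 - z * x $ (7 - p) \<noteq> 0 \<and> cmod (x $ p - z * x $ 7) \<le> cmod (1 - z * x $ (7 - p))"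
    if "p \<in> {1, 2, 4}" for p
    using disc_pencil_swap[of "x $ p" "x $ (7 - p)" "x $ 7" z] diag[OF that] z by simp
  have "7 - i \<in> {1, 2, 4} \<or> i \<in> {1, 2, 4}"
    using i unfolding index_seven(1) by (auto simp: index_seven)
  then show ?thesis
    using diag[of "7 - i" z] minor[of i] z by auto
qed

section \<open>From the domain to the operators\<close>

lemma mholomorphic_const: "open U \<Longrightarrow> (\<lambda>x. c) mholomorphic_on U"
  unfolding mholomorphic_on_def by (auto intro!: exI[of _ "\<lambda>x. 0"])

lemma mholomorphic_coord: "open U \<Longrightarrow> (\<lambda>x. x $ i) mholomorphic_on U"
  unfolding mholomorphic_on_def
  by (auto intro!: exI[of _ "\<lambda>x. x $ i"] bounded_linear_imp_has_derivative bounded_linear_vec_nth)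

lemma mholomorphic_add:
  assumes "f mholomorphic_on U" "g mholomorphic_on U"
  shows "(\<lambda>x. f x + g x) mholomorphic_on U"
  unfolding mholomorphic_on_def
proof (intro conjI ballI)
  show "open U" using assms(1) by (simp add: mholomorphic_on_def)
  fix z assume "z \<in> U"
  then obtain f' g' where "(f has_derivative f') (at z)" "\<forall>c v. f' (c *s v) = c * f' v"
      "(g has_derivative g') (at z)" "\<forall>c v. g' (c *s v) = c * g' v"
    using assms unfolding mholomorphic_on_def by meson
  then show "\<exists>h. ((\<lambda>x. f x + g x) has_derivative h) (at z) \<and> (\<forall>c v. h (c *s v) = c * h v)"
    by (intro exI[of _ "\<lambda>v. f' v + g' v"]) (auto simp: distrib_left intro: has_derivative_add)
qed

lemma mholomorphic_mult:
  assumes "f mholomorphic_on U" "g mholomorphic_on U"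
  shows "(\<lambda>x. f x * g x) mholomorphic_on U"
  unfolding mholomorphic_on_def
proof (intro conjI ballI)
  show "open U" using assms(1) by (simp add: mholomorphic_on_def)
  fix z assume "z \<in> U"
  then obtain f' g' where "(f has_derivative f') (at z)" "\<forall>c v. f' (c *s v) = c * f' v"
      "(g has_derivative g') (at z)" "\<forall>c v. g' (c *s v) = c * g' v"
    using assms unfolding mholomorphic_on_def by meson
  then show "\<exists>h. ((\<lambda>x. f x * g x) has_derivative h) (at z) \<and> (\<forall>c v. h (c *s v) = c * h v)"
    by (intro exI[of _ "\<lambda>v. f z * g' v + f' v * g z"])
      (auto simp: algebra_simps intro: has_derivative_mult)
qed

lemma mholomorphic_inverse:
  assumes "f mholomorphic_on U" "\<And>z. z \<in> U \<Longrightarrow> f z \<noteq> 0"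
  shows "(\<lambda>x. inverse (f x)) mholomorphic_on U"
  unfolding mholomorphic_on_def
proof (intro conjI ballI)
  show "open U" using assms(1) by (simp add: mholomorphic_on_def)
  fix z assume z: "z \<in> U"
  then obtain f' where "(f has_derivative f') (at z)" "\<forall>c v. f' (c *s v) = c * f' v"
    using assms by (auto simp: mholomorphic_on_def)
  then show "\<exists>h. ((\<lambda>x. inverse (f x)) has_derivative h) (at z) \<and> (\<forall>c v. h (c *s v) = c * h v)"
    using assms(2)[OF z]
    by (intro exI[of _ "\<lambda>v. - (inverse (f z) * f' v * inverse (f z))"])
      (auto intro: has_derivative_inverse)
qed

lemma zero_in_Gamma_E: "0 \<in> Gamma_E"
proof -
  have "mu_witnesses 0 = {}" by (auto simp: mu_witnesses_def)
  then have "mu 0 = 0" by (simp add: mu_def)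
  then show ?thesis unfolding Gamma_E_def by (auto intro!: exI[of _ 0] simp: det_3)
qed

text \<open>
  By the scalar inequality, the function \<open>f = (x\<^sub>i - c x\<^sub>7) / (1 - c x\<^sub>7\<^sub>-\<^sub>i)\<close> is holomorphic near the domain and
  bounded by one on it, so \<open>f(T)\<close> is a contraction. Since the calculus is multiplicative, it maps
  \<open>(I - c T\<^sub>7\<^sub>-\<^sub>i) h\<close> to \<open>(T\<^sub>i - c T\<^sub>7) h\<close>. The condition \<open>|c| < 1\<close> keeps the pole of \<open>f\<close> away from the
  domain.
\<close>

lemma Gamma_E_contraction_open_pencil:
  fixes T :: "7 \<Rightarrow> 'a::chilbert_space \<Rightarrow> 'a"
  assumes T: "Gamma_E_contraction T" and i: "i \<in> {1..6}" and c: "cmod c < 1"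
  shows "norm (T i h - c *\<^sub>C T 7 h) \<le> norm (h - c *\<^sub>C T (7 - i) h)"
proof -
  obtain \<Phi> where sp: "taylor_spectrum T \<subseteq> Gamma_E" and \<Phi>: "taylor_calculus T \<Phi>"
    and vN: "\<And>U f. Gamma_E \<subseteq> U \<Longrightarrow> f mholomorphic_on U \<Longrightarrow>
        onorm (\<Phi> f) \<le> (SUP z\<in>Gamma_E. cmod (f z))"
    using T unfolding Gamma_E_contraction_def spectral_set_def by blast
  define U where "U = {x :: complex ^ 7. 1 + (- c) * x $ (7 - i) \<noteq> 0}"
  have U: "open U"
    unfolding U_def by (intro open_Collect_neq continuous_intros)
  have GU: "Gamma_E \<subseteq> U" using Gamma_E_pencil[OF _ i c] by (auto simp: U_def)
  have \<Phi>_const: "\<Phi> (\<lambda>z. a) = (\<lambda>x. a *\<^sub>C x)" and \<Phi>_coord: "\<Phi> (\<lambda>z. z $ j) = T j" for a j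
    using \<Phi> by (simp_all add: taylor_calculus_def)
  have spU: "open U \<and> taylor_spectrum T \<subseteq> U" using U sp GU by blast
  have \<Phi>_bounded: "f mholomorphic_on U \<Longrightarrow> \<Phi> f \<in> bounded_ops UNIV"
    and \<Phi>_add: "f mholomorphic_on U \<Longrightarrow> g mholomorphic_on U \<Longrightarrow>
        \<Phi> (\<lambda>z. f z + g z) = (\<lambda>x. \<Phi> f x + \<Phi> g x)"
    and \<Phi>_mult: "f mholomorphic_on U \<Longrightarrow> g mholomorphic_on U \<Longrightarrow>
        \<Phi> (\<lambda>z. f z * g z) = \<Phi> f \<circ> \<Phi> g"
    and \<Phi>_cong: "f mholomorphic_on U \<Longrightarrow> g mholomorphic_on U \<Longrightarrow>
        (\<And>z. z \<in> U \<Longrightarrow> f z = g z) \<Longrightarrow> \<Phi> f = \<Phi> g" for f g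
    using \<Phi>[unfolded taylor_calculus_def, THEN conjunct2, THEN conjunct2, rule_format, OF spU]
    by metis+
  note hol = mholomorphic_const[OF U] mholomorphic_coord[OF U]
  note hol = hol mholomorphic_mult[OF hol] mholomorphic_add mholomorphic_mult mholomorphic_inverse
  define q where "q x = 1 + (- c) * x $ (7 - i)" for x :: "complex ^ 7"
  define n where "n x = x $ i + (- c) * x $ 7" for x :: "complex ^ 7"
  define f where "f x = inverse (q x) * n x" for x
  have q: "q mholomorphic_on U" and n: "n mholomorphic_on U"
    unfolding q_def n_def by (intro hol)+
  have f: "f mholomorphic_on U"
    unfolding f_def by (intro hol n q) (simp add: q_def U_def)
  have \<Phi>_aff: "\<Phi> (\<lambda>x. (- c) * x $ j) = (\<lambda>h. (- c) *\<^sub>C T j h)" for j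
    by (subst \<Phi>_mult) (auto intro: hol simp: \<Phi>_const \<Phi>_coord)
  have \<Phi>q: "\<Phi> q h = h - c *\<^sub>C T (7 - i) h" for h
    unfolding q_def \<Phi>_add[OF hol(1,3)] \<Phi>_const \<Phi>_aff by (simp add: scaleC_minus_left)
  have \<Phi>n: "\<Phi> n h = T i h - c *\<^sub>C T 7 h" for h
    unfolding n_def \<Phi>_add[OF hol(2,3)] \<Phi>_coord \<Phi>_aff by (simp add: scaleC_minus_left)
  have "\<Phi> (\<lambda>x. f x * q x) = \<Phi> n"
  proof (rule \<Phi>_cong[OF mholomorphic_mult[OF f q] n])
    fix z assume "z \<in> U"
    then show "f z * q z = n z" by (simp add: f_def U_def q_def)
  qed
  then have fact: "\<Phi> f (\<Phi> q h) = \<Phi> n h" unfolding \<Phi>_mult[OF f q] by (metis comp_apply)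
  have "onorm (\<Phi> f) \<le> (SUP z\<in>Gamma_E. cmod (f z))" by (rule vN[OF GU f])
  also have "\<dots> \<le> 1"
  proof (rule cSUP_least)
    show "Gamma_E \<noteq> {}" using zero_in_Gamma_E by blast
    fix x assume "x \<in> Gamma_E"
    then have "q x \<noteq> 0" "cmod (n x) \<le> cmod (q x)"
      using Gamma_E_pencil[OF _ i c] by (auto simp: q_def n_def)
    then show "cmod (f x) \<le> 1" by (simp add: f_def norm_divide divide_le_eq flip: divide_inverse_commute)
  qed
  finally have "onorm (\<Phi> f) \<le> 1" .
  have "norm (\<Phi> f (\<Phi> q h)) \<le> onorm (\<Phi> f) * norm (\<Phi> q h)"
    by (rule onorm[OF bounded_linear_if_bounded_ops[OF \<Phi>_bounded[OF f]]])
  also have "\<dots> \<le> 1 * norm (\<Phi> q h)" by (intro mult_right_mono \<open>onorm (\<Phi> f) \<le> 1\<close>) simp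
  finally show ?thesis unfolding fact unfolding \<Phi>q \<Phi>n by simp
qed

lemma Gamma_E_contraction_pencil:
  fixes T :: "7 \<Rightarrow> 'a::chilbert_space \<Rightarrow> 'a"
  assumes T: "Gamma_E_contraction T" and i: "i \<in> {1..6}" and z: "cmod z = 1"
  shows "norm (T i h - z *\<^sub>C T 7 h) \<le> norm (h - z *\<^sub>C T (7 - i) h)"
proof (rule LIMSEQ_le)
  define r where "r n = real n / real (Suc n)" for n
  have r: "r \<longlonglongrightarrow> 1" unfolding r_def by (rule LIMSEQ_n_over_Suc_n)
  have lim: "(\<lambda>n. norm (x - r n *\<^sub>R y)) \<longlonglongrightarrow> norm (x - y)" for x y :: 'a
    using tendsto_norm[OF tendsto_diff[OF tendsto_const tendsto_scaleR[OF r tendsto_const]], of x y]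
    by simp
  show "(\<lambda>n. norm (T i h - r n *\<^sub>R z *\<^sub>C T 7 h)) \<longlonglongrightarrow> norm (T i h - z *\<^sub>C T 7 h)"
    and "(\<lambda>n. norm (h - r n *\<^sub>R z *\<^sub>C T (7 - i) h)) \<longlonglongrightarrow> norm (h - z *\<^sub>C T (7 - i) h)"
    by (rule lim)+
  have "norm (T i h - r n *\<^sub>R z *\<^sub>C T 7 h) \<le> norm (h - r n *\<^sub>R z *\<^sub>C T (7 - i) h)" for n
  proof -
    have "0 \<le> r n" "r n < 1" by (simp_all add: r_def)
    then have "cmod (complex_of_real (r n) * z) < 1" using z by (simp add: norm_mult)
    from Gamma_E_contraction_open_pencil[OF T i this, of h]
    show ?thesis by (simp add: scaleC_of_real flip: scaleC_scaleC)
  qed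
  then show "\<exists>N. \<forall>n\<ge>N. norm (T i h - r n *\<^sub>R z *\<^sub>C T 7 h) \<le> norm (h - r n *\<^sub>R z *\<^sub>C T (7 - i) h)"
    by blast
qed

theorem lemma2p7:
  fixes T :: "7 \<Rightarrow> 'a::chilbert_space \<Rightarrow> 'a"
  assumes "Gamma_E_contraction T"
  shows "\<exists>F. fundamental_operators T F \<and>
    (\<forall>X \<in> op_tuples (defect_space (T 7)).
      (\<forall>i\<in>{1..6}. \<forall>h.
         defect_op (T 7) (T i h) =
           X i (defect_op (T 7) h) +
           adj_on (defect_space (T 7)) (X (7 - i)) (defect_op (T 7) (T 7 h)) \<and>
         defect_op (T 7) (T (7 - i) h) =
           X (7 - i) (defect_op (T 7) h) +
           adj_on (defect_space (T 7)) (X i) (defect_op (T 7) (T 7 h)))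
      \<longleftrightarrow> X = F)"
  using assms
  by (intro fundamental_operators_characterization Gamma_E_contraction_pencil)
    (auto simp: Gamma_E_contraction_def)

end
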